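(* Let $\sigma$ be a signature. For all sets $\Gamma\subseteq\mathrm{Sent}_\sigma$ and $\Delta\subseteq\mathrm{Form}_\sigma$: $\Gamma\vdash\Delta$ if and only if $\Gamma\vDash\Delta$.
   Context: Syntax. A signature $\sigma$ is a set of predicate symbols (each with an arity) and constant symbols; there are no function symbols. $\mathrm{Var}$ is a fixed countable set of variables; the $\sigma$-terms are the variables and the constants of $\sigma$. The $\sigma$-formulas (set $\mathrm{Form}_\sigma$) are built from atomic formulas $P(t_1,\dots,t_n)$ and the constant $\bot$ using the binary connectives $\rightarrow,\wedge,\vee$, the unary strong negation $\sim$, the modal operators $\Box,\Diamond$ and the quantifiers $\forall x,\exists x$. $\mathrm{Sent}_\sigma$ is the set of $\sigma$-sentences (no free variables). Abbreviations: $\neg\Phi:=\Phi\rightarrow\bot$, $\Phi\leftrightarrow\Psi:=(\Phi\rightarrow\Psi)\wedge(\Psi\rightarrow\Phi)$, $\Phi\Leftrightarrow\Psi:=(\Phi\leftrightarrow\Psi)\wedge({\sim\Phi}\leftrightarrow{\sim\Psi})$. $\Phi(x/t)$ denotes the result of substituting the term $t$ for the free occurrences of $x$ in $\Phi$. Calculus. $\mathsf{QBK}_\sigma$ is the smallest set of $\sigma$-formulas containing all instances of the following axiom schemes and closed under the rules below. Axioms: $\Phi\rightarrow(\Psi\rightarrow\Phi)$; $(\Phi\rightarrow(\Psi\rightarrow\Theta))\rightarrow((\Phi\rightarrow\Psi)\rightarrow(\Phi\rightarrow\Theta))$; $\Phi\wedge\Psi\rightarrow\Phi$; $\Phi\wedge\Psi\rightarrow\Psi$;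 $\Phi\rightarrow(\Psi\rightarrow\Phi\wedge\Psi)$; $\Phi\rightarrow\Phi\vee\Psi$; $\Psi\rightarrow\Phi\vee\Psi$; $(\Phi\rightarrow\Theta)\rightarrow((\Psi\rightarrow\Theta)\rightarrow(\Phi\vee\Psi\rightarrow\Theta))$; $\Phi\vee(\Phi\rightarrow\bot)$; $\bot\rightarrow\Phi$; ${\sim\sim\Phi}\leftrightarrow\Phi$; ${\sim(\Phi\rightarrow\Psi)}\leftrightarrow(\Phi\wedge{\sim\Psi})$; ${\sim(\Phi\vee\Psi)}\leftrightarrow({\sim\Phi}\wedge{\sim\Psi})$; ${\sim(\Phi\wedge\Psi)}\leftrightarrow({\sim\Phi}\vee{\sim\Psi})$; ${\sim\bot}$; $(\Box\Phi\wedge\Box\Psi)\rightarrow\Box(\Phi\wedge\Psi)$; $\Box(\Phi\rightarrow\Phi)$; $\neg\Box\Phi\leftrightarrow\Diamond\neg\Phi$; $\neg\Diamond\Phi\leftrightarrow\Box\neg\Phi$; $\Box\Phi\Leftrightarrow{\sim\Diamond{\sim\Phi}}$; $\Diamond\Phi\Leftrightarrow{\sim\Box{\sim\Phi}}$; $\forall x\Phi\rightarrow\Phi(x/t)$ and $\Phi(x/t)\rightarrow\exists x\Phi$ ($t$ free for $x$ in $\Phi$); ${\sim\forall x\Phi}\leftrightarrow\exists x{\sim\Phi}$; ${\sim\exists x\Phi}\leftrightarrow\forall x{\sim\Phi}$. Rules: MP: from $\Phi$ and $\Phi\rightarrow\Psi$ infer $\Psi$; MB: from $\Phi\rightarrow\Psi$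 infer $\Box\Phi\rightarrow\Box\Psi$; MD: from $\Phi\rightarrow\Psi$ infer $\Diamond\Phi\rightarrow\Diamond\Psi$; BR1: from $\Phi\rightarrow\Psi$ infer $\Phi\rightarrow\forall x\Psi$ if $x$ is not free in $\Phi$; BR2: from $\Phi\rightarrow\Psi$ infer $\exists x\Phi\rightarrow\Psi$ if $x$ is not free in $\Psi$. Derivability. For $\Delta\subseteq\mathrm{Form}_\sigma$, $\mathrm{Disj}(\Delta)$ is the set of disjunctions $\Phi_1\vee\dots\vee\Phi_n$ with $\{\Phi_1,\dots,\Phi_n\}\subseteq\Delta$, $n\ge 0$ (the empty disjunction is $\bot$). For $\Gamma\subseteq\mathrm{Sent}_\sigma$, $\Delta\subseteq\mathrm{Form}_\sigma$: $\Gamma\vdash\Delta$ iff some element of $\mathrm{Disj}(\Delta)$ can be obtained from elements of $\Gamma\cup\mathsf{QBK}_\sigma$ using only MP, BR1, BR2. Semantics. A $\mathsf{QBK}_\sigma$-model is $\mathcal M=\langle\langle W,R\rangle,(\mathfrak A^+_w)_{w\in W},(\mathfrak A^-_w)_{w\in W}\rangle$ with $W\neq\emptyset$, $R\subseteq W\times W$, where for each $w$, $\mathfrak A^+_w,\mathfrak A^-_w$ are $\sigma$-structures with a common domain $A_w$ and the same interpretation of constants, and whenever $uRv$: $A_u\subseteq A_v$ and each constant of $\sigma$ has the same interpretation in $\mathfrak A^+_u$ and $\mathfrak A^+_v$. For a set $A$, $\sigma_A$ is $\sigma$ extended by new constants $\underline a$ ($a\in A$), interpreted as $a$; $A$-sentences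 are $\sigma_A$-sentences; an $A$-substitution is a map $\lambda:\mathrm{Var}\to$ $\sigma_A$-terms, ground if all values are constants; $\lambda\Phi$ is the simultaneous substitution of $\lambda(x)$ for the free occurrences of each $x$. Verification $\Vdash^+$ and falsification $\Vdash^-$ of an $A_w$-sentence at $w$: atomic $\Theta$: $\mathcal M,w\Vdash^+\Theta$ iff $\mathfrak A^+_w\models\Theta$, $\mathcal M,w\Vdash^-\Theta$ iff $\mathfrak A^-_w\models\Theta$; $\bot$ is never verified and always falsified; $\Phi\wedge\Psi$: verified iff both are verified, falsified iff at least one is falsified; $\Phi\vee\Psi$: verified iff at least one is verified, falsified iff both are falsified; $\Phi\rightarrow\Psi$: verified iff $\Phi$ is not verified or $\Psi$ is verified, falsified iff $\Phi$ is verified and $\Psi$ is falsified; ${\sim\Phi}$: verified iff $\Phi$ falsified, falsified iff $\Phi$ verified; $\Box\Phi$: verified at $w$ iff $\Phi$ is verified at every $u$ with $wRu$, falsified iff $\Phi$ is falsified at some $u$ with $wRu$; $\Diamond\Phi$: verified iff $\Phi$ is verified at some $u$ with $wRu$, falsified iff $\Phi$ is falsified at every $u$ with $wRu$; $\forall x\Phi$: verified iff $\Phi(x/\underline a)$ is verified for all $a\in A_w$, falsified iff $\Phi(x/\underline a)$ is falsified for some $a\in A_w$; $\exists x\Phi$: verified iff $\Phi(x/\underline a)$ verified for some $a\in A_w$, falsified iff $\Phi(x/\underline a)$ falsified for all $a\in A_w$. For $\Gamma\subseteq\mathrm{Sent}_\sigma$, $\Delta\subseteq\mathrm{Form}_\sigma$: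 $\Gamma\vDash\Delta$ iff for every $\mathsf{QBK}_\sigma$-model $\mathcal M$, every world $w$ and every ground $A_w$-substitution $\lambda$: if $\mathcal M,w\Vdash^+\Phi$ for all $\Phi\in\Gamma$, then $\mathcal M,w\Vdash^+\lambda\Psi$ for some $\Psi\in\Delta$. *)

theory Defs
  imports Main
begin

section \<open>Syntax\<close>

record ('p, 'c) signature =
  preds :: "'p set"
  arity :: "'p \<Rightarrow> nat"
  csts :: "'c set"

datatype 'c tm = Var nat | Cst 'c

datatype ('p, 'c) fm =
    Atom 'p "'c tm list"
  | Bot
  | Imp "('p, 'c) fm" "('p, 'c) fm"
  | And "('p, 'c) fm" "('p, 'c) fm"
  | Or "('p, 'c) fm" "('p, 'c) fm"
  | SNeg "('p, 'c) fm"
  | Box "('p, 'c) fm"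
  | Dia "('p, 'c) fm"
  | Forall nat "('p, 'c) fm"
  | Exists nat "('p, 'c) fm"

abbreviation Neg :: "('p, 'c) fm \<Rightarrow> ('p, 'c) fm" where
  "Neg F \<equiv> Imp F Bot"

abbreviation Iff :: "('p, 'c) fm \<Rightarrow> ('p, 'c) fm \<Rightarrow> ('p, 'c) fm" where
  "Iff F G \<equiv> And (Imp F G) (Imp G F)"

abbreviation SIff :: "('p, 'c) fm \<Rightarrow> ('p, 'c) fm \<Rightarrow> ('p, 'c) fm" where
  "SIff F G \<equiv> And (Iff F G) (Iff (SNeg F) (SNeg G))"

definition Tm :: "('p, 'c) signature \<Rightarrow> 'c tm set" where
  "Tm \<sigma> = range Var \<union> Cst ` csts \<sigma>"

primrec wf_fm :: "('p, 'c) signature \<Rightarrow> ('p, 'c) fm \<Rightarrow> bool" where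
  "wf_fm \<sigma> (Atom P ts) \<longleftrightarrow> P \<in> preds \<sigma> \<and> length ts = arity \<sigma> P \<and> set ts \<subseteq> Tm \<sigma>"
| "wf_fm \<sigma> Bot \<longleftrightarrow> True"
| "wf_fm \<sigma> (Imp F G) \<longleftrightarrow> wf_fm \<sigma> F \<and> wf_fm \<sigma> G"
| "wf_fm \<sigma> (And F G) \<longleftrightarrow> wf_fm \<sigma> F \<and> wf_fm \<sigma> G"
| "wf_fm \<sigma> (Or F G) \<longleftrightarrow> wf_fm \<sigma> F \<and> wf_fm \<sigma> G"
| "wf_fm \<sigma> (SNeg F) \<longleftrightarrow> wf_fm \<sigma> F"
| "wf_fm \<sigma> (Box F) \<longleftrightarrow> wf_fm \<sigma> F"
| "wf_fm \<sigma> (Dia F) \<longleftrightarrow> wf_fm \<sigma> F"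
| "wf_fm \<sigma> (Forall x F) \<longleftrightarrow> wf_fm \<sigma> F"
| "wf_fm \<sigma> (Exists x F) \<longleftrightarrow> wf_fm \<sigma> F"

primrec fv_tm :: "'c tm \<Rightarrow> nat set" where
  "fv_tm (Var x) = {x}"
| "fv_tm (Cst c) = {}"

primrec fv :: "('p, 'c) fm \<Rightarrow> nat set" where
  "fv (Atom P ts) = (\<Union>t\<in>set ts. fv_tm t)"
| "fv Bot = {}"
| "fv (Imp F G) = fv F \<union> fv G"
| "fv (And F G) = fv F \<union> fv G"
| "fv (Or F G) = fv F \<union> fv G"
| "fv (SNeg F) = fv F"
| "fv (Box F) = fv F"
| "fv (Dia F) = fv F"
| "fv (Forall x F) = fv F - {x}"
| "fv (Exists x F) = fv F - {x}"

definition Form :: "('p, 'c) signature \<Rightarrow> ('p, 'c) fm set" where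
  "Form \<sigma> = {F. wf_fm \<sigma> F}"

definition Sent :: "('p, 'c) signature \<Rightarrow> ('p, 'c) fm set" where
  "Sent \<sigma> = {F \<in> Form \<sigma>. fv F = {}}"

primrec subst_tm :: "(nat \<Rightarrow> 'c tm) \<Rightarrow> 'c tm \<Rightarrow> 'c tm" where
  "subst_tm s (Var x) = s x"
| "subst_tm s (Cst c) = Cst c"

text \<open>Simultaneous substitution for the free occurrences of variables. Bound variables are never
  renamed, so capture has to be excluded by a side condition.\<close>

primrec subst :: "(nat \<Rightarrow> 'c tm) \<Rightarrow> ('p, 'c) fm \<Rightarrow> ('p, 'c) fm" where
  "subst s (Atom P ts) = Atom P (map (subst_tm s) ts)"
| "subst s Bot = Bot"
| "subst s (Imp F G) = Imp (subst s F) (subst s G)"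
| "subst s (And F G) = And (subst s F) (subst s G)"
| "subst s (Or F G) = Or (subst s F) (subst s G)"
| "subst s (SNeg F) = SNeg (subst s F)"
| "subst s (Box F) = Box (subst s F)"
| "subst s (Dia F) = Dia (subst s F)"
| "subst s (Forall x F) = Forall x (subst (s(x := Var x)) F)"
| "subst s (Exists x F) = Exists x (subst (s(x := Var x)) F)"

definition subst1 :: "nat \<Rightarrow> 'c tm \<Rightarrow> ('p, 'c) fm \<Rightarrow> ('p, 'c) fm" where
  "subst1 x t F = subst (Var(x := t)) F"

primrec free_for :: "'c tm \<Rightarrow> nat \<Rightarrow> ('p, 'c) fm \<Rightarrow> bool" where
  "free_for t x (Atom P ts) \<longleftrightarrow> True"
| "free_for t x Bot \<longleftrightarrow> True"
| "free_for t x (Imp F G) \<longleftrightarrow> free_for t x F \<and> free_for t x G"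
| "free_for t x (And F G) \<longleftrightarrow> free_for t x F \<and> free_for t x G"
| "free_for t x (Or F G) \<longleftrightarrow> free_for t x F \<and> free_for t x G"
| "free_for t x (SNeg F) \<longleftrightarrow> free_for t x F"
| "free_for t x (Box F) \<longleftrightarrow> free_for t x F"
| "free_for t x (Dia F) \<longleftrightarrow> free_for t x F"
| "free_for t x (Forall y F) \<longleftrightarrow> x \<notin> fv (Forall y F) \<or> (y \<notin> fv_tm t \<and> free_for t x F)"
| "free_for t x (Exists y F) \<longleftrightarrow> x \<notin> fv (Exists y F) \<or> (y \<notin> fv_tm t \<and> free_for t x F)"

section \<open>Calculus\<close>

inductive axiom :: "('p, 'c) fm \<Rightarrow> bool" where
  "axiom (Imp F (Imp G F))"
| "axiom (Imp (Imp F (Imp G H)) (Imp (Imp F G) (Imp F H)))"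
| "axiom (Imp (And F G) F)"
| "axiom (Imp (And F G) G)"
| "axiom (Imp F (Imp G (And F G)))"
| "axiom (Imp F (Or F G))"
| "axiom (Imp G (Or F G))"
| "axiom (Imp (Imp F H) (Imp (Imp G H) (Imp (Or F G) H)))"
| "axiom (Or F (Imp F Bot))"
| "axiom (Imp Bot F)"
| "axiom (Iff (SNeg (SNeg F)) F)"
| "axiom (Iff (SNeg (Imp F G)) (And F (SNeg G)))"
| "axiom (Iff (SNeg (Or F G)) (And (SNeg F) (SNeg G)))"
| "axiom (Iff (SNeg (And F G)) (Or (SNeg F) (SNeg G)))"
| "axiom (SNeg Bot)"
| "axiom (Imp (And (Box F) (Box G)) (Box (And F G)))"
| "axiom (Box (Imp F F))"
| "axiom (Iff (Neg (Box F)) (Dia (Neg F)))"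
| "axiom (Iff (Neg (Dia F)) (Box (Neg F)))"
| "axiom (SIff (Box F) (SNeg (Dia (SNeg F))))"
| "axiom (SIff (Dia F) (SNeg (Box (SNeg F))))"
| "free_for t x F \<Longrightarrow> axiom (Imp (Forall x F) (subst1 x t F))"
| "free_for t x F \<Longrightarrow> axiom (Imp (subst1 x t F) (Exists x F))"
| "axiom (Iff (SNeg (Forall x F)) (Exists x (SNeg F)))"
| "axiom (Iff (SNeg (Exists x F)) (Forall x (SNeg F)))"

inductive_set QBK :: "('p, 'c) signature \<Rightarrow> ('p, 'c) fm set" for \<sigma> :: "('p, 'c) signature" where
  Ax: "axiom F \<Longrightarrow> F \<in> Form \<sigma> \<Longrightarrow> F \<in> QBK \<sigma>"
| MP: "F \<in> QBK \<sigma> \<Longrightarrow> Imp F G \<in> QBK \<sigma> \<Longrightarrow> G \<in> QBK \<sigma>"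
| MB: "Imp F G \<in> QBK \<sigma> \<Longrightarrow> Imp (Box F) (Box G) \<in> QBK \<sigma>"
| MD: "Imp F G \<in> QBK \<sigma> \<Longrightarrow> Imp (Dia F) (Dia G) \<in> QBK \<sigma>"
| BR1: "Imp F G \<in> QBK \<sigma> \<Longrightarrow> x \<notin> fv F \<Longrightarrow> Imp F (Forall x G) \<in> QBK \<sigma>"
| BR2: "Imp F G \<in> QBK \<sigma> \<Longrightarrow> x \<notin> fv G \<Longrightarrow> Imp (Exists x F) G \<in> QBK \<sigma>"

inductive_set consequences :: "('p, 'c) signature \<Rightarrow> ('p, 'c) fm set \<Rightarrow> ('p, 'c) fm set"
  for \<sigma> :: "('p, 'c) signature" and \<Gamma> :: "('p, 'c) fm set" where
  base: "F \<in> \<Gamma> \<union> QBK \<sigma> \<Longrightarrow> F \<in> consequences \<sigma> \<Gamma>"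
| MP: "F \<in> consequences \<sigma> \<Gamma> \<Longrightarrow> Imp F G \<in> consequences \<sigma> \<Gamma> \<Longrightarrow> G \<in> consequences \<sigma> \<Gamma>"
| BR1: "Imp F G \<in> consequences \<sigma> \<Gamma> \<Longrightarrow> x \<notin> fv F \<Longrightarrow> Imp F (Forall x G) \<in> consequences \<sigma> \<Gamma>"
| BR2: "Imp F G \<in> consequences \<sigma> \<Gamma> \<Longrightarrow> x \<notin> fv G \<Longrightarrow> Imp (Exists x F) G \<in> consequences \<sigma> \<Gamma>"

fun disjunction :: "('p, 'c) fm list \<Rightarrow> ('p, 'c) fm" where
  "disjunction [] = Bot"
| "disjunction [F] = F"
| "disjunction (F # G # Fs) = Or F (disjunction (G # Fs))"

definition Disj :: "('p, 'c) fm set \<Rightarrow> ('p, 'c) fm set" where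
  "Disj \<Delta> = {disjunction Fs | Fs. set Fs \<subseteq> \<Delta>}"

definition derives :: "('p, 'c) signature \<Rightarrow> ('p, 'c) fm set \<Rightarrow> ('p, 'c) fm set \<Rightarrow> bool" where
  "derives \<sigma> \<Gamma> \<Delta> \<longleftrightarrow> (\<exists>F \<in> Disj \<Delta>. F \<in> consequences \<sigma> \<Gamma>)"

section \<open>Semantics\<close>

record ('p, 'c, 'a) struct =
  carr :: "'a set"
  cint :: "'c \<Rightarrow> 'a"
  pint :: "'p \<Rightarrow> 'a list set"

definition is_struct :: "('p, 'c) signature \<Rightarrow> ('p, 'c, 'a) struct \<Rightarrow> bool" where
  "is_struct \<sigma> \<AA> \<longleftrightarrow>
     carr \<AA> \<noteq> {} \<and>
     (\<forall>c \<in> csts \<sigma>. cint \<AA> c \<in> carr \<AA>) \<and>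
     (\<forall>P \<in> preds \<sigma>. pint \<AA> P \<subseteq> {as. length as = arity \<sigma> P \<and> set as \<subseteq> carr \<AA>})"

record ('p, 'c, 'a, 'w) model =
  worlds :: "'w set"
  acc :: "('w \<times> 'w) set"
  pos :: "'w \<Rightarrow> ('p, 'c, 'a) struct"
  neg :: "'w \<Rightarrow> ('p, 'c, 'a) struct"

definition is_model :: "('p, 'c) signature \<Rightarrow> ('p, 'c, 'a, 'w) model \<Rightarrow> bool" where
  "is_model \<sigma> M \<longleftrightarrow>
     worlds M \<noteq> {} \<and>
     acc M \<subseteq> worlds M \<times> worlds M \<and>
     (\<forall>w \<in> worlds M.
        is_struct \<sigma> (pos M w) \<and> is_struct \<sigma> (neg M w) \<and>
        carr (pos M w) = carr (neg M w) \<and>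
        (\<forall>c \<in> csts \<sigma>. cint (pos M w) c = cint (neg M w) c)) \<and>
     (\<forall>(u, v) \<in> acc M.
        carr (pos M u) \<subseteq> carr (pos M v) \<and>
        (\<forall>c \<in> csts \<sigma>. cint (pos M u) c = cint (pos M v) c))"

text \<open>In the extended signature \<open>Inl c\<close> is the constant \<open>c\<close> of \<open>\<sigma>\<close> and \<open>Inr a\<close> is the new
  constant naming the element \<open>a\<close>; \<open>lift\<close> is the inclusion of the \<open>\<sigma>\<close>-formulas into the formulas
  of the extended signature.\<close>

definition sig_ext :: "('p, 'c) signature \<Rightarrow> 'a set \<Rightarrow> ('p, 'c + 'a) signature" where
  "sig_ext \<sigma> A = \<lparr>preds = preds \<sigma>, arity = arity \<sigma>, csts = Inl ` csts \<sigma> \<union> Inr ` A\<rparr>"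

definition lift :: "('p, 'c) fm \<Rightarrow> ('p, 'c + 'a) fm" where
  "lift = map_fm id Inl"

definition is_subst :: "('p, 'c) signature \<Rightarrow> 'a set \<Rightarrow> (nat \<Rightarrow> ('c + 'a) tm) \<Rightarrow> bool" where
  "is_subst \<sigma> A s \<longleftrightarrow> (\<forall>x. s x \<in> Tm (sig_ext \<sigma> A))"

definition ground :: "(nat \<Rightarrow> 'c tm) \<Rightarrow> bool" where
  "ground s \<longleftrightarrow> (\<forall>x. \<exists>c. s x = Cst c)"

text \<open>Only closed terms are ever evaluated; the value of a variable is left unspecified.\<close>

fun tm_val :: "('p, 'c, 'a) struct \<Rightarrow> ('c + 'a) tm \<Rightarrow> 'a" where
  "tm_val \<AA> (Cst (Inl c)) = cint \<AA> c"
| "tm_val \<AA> (Cst (Inr a)) = a"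
| "tm_val \<AA> (Var x) = undefined"

lemma size_subst [simp]: "size (subst s F) = size F"
proof (induction F arbitrary: s)
  case (Atom P ts)
  have "size (subst_tm s t) = size t" for t
    by (cases t; cases "subst_tm s t") simp_all
  then show ?case
    by (simp add: comp_def)
qed simp_all

text \<open>\<open>verifies M w F\<close> and \<open>falsifies M w F\<close> are meant for sentences \<open>F\<close> of \<open>\<sigma>\<close> extended by the
  elements of the domain of \<open>w\<close>.\<close>

function (sequential)
  verifies :: "('p, 'c, 'a, 'w) model \<Rightarrow> 'w \<Rightarrow> ('p, 'c + 'a) fm \<Rightarrow> bool" and
  falsifies :: "('p, 'c, 'a, 'w) model \<Rightarrow> 'w \<Rightarrow> ('p, 'c + 'a) fm \<Rightarrow> bool"
where
  "verifies M w (Atom P ts) \<longleftrightarrow> map (tm_val (pos M w)) ts \<in> pint (pos M w) P"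
| "verifies M w Bot \<longleftrightarrow> False"
| "verifies M w (Imp F G) \<longleftrightarrow> \<not> verifies M w F \<or> verifies M w G"
| "verifies M w (And F G) \<longleftrightarrow> verifies M w F \<and> verifies M w G"
| "verifies M w (Or F G) \<longleftrightarrow> verifies M w F \<or> verifies M w G"
| "verifies M w (SNeg F) \<longleftrightarrow> falsifies M w F"
| "verifies M w (Box F) \<longleftrightarrow> (\<forall>u. (w, u) \<in> acc M \<longrightarrow> verifies M u F)"
| "verifies M w (Dia F) \<longleftrightarrow> (\<exists>u. (w, u) \<in> acc M \<and> verifies M u F)"
| "verifies M w (Forall x F) \<longleftrightarrow> (\<forall>a \<in> carr (pos M w). verifies M w (subst1 x (Cst (Inr a)) F))"
| "verifies M w (Exists x F) \<longleftrightarrow> (\<exists>a \<in> carr (pos M w). verifies M w (subst1 x (Cst (Inr a)) F))"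
| "falsifies M w (Atom P ts) \<longleftrightarrow> map (tm_val (neg M w)) ts \<in> pint (neg M w) P"
| "falsifies M w Bot \<longleftrightarrow> True"
| "falsifies M w (Imp F G) \<longleftrightarrow> verifies M w F \<and> falsifies M w G"
| "falsifies M w (And F G) \<longleftrightarrow> falsifies M w F \<or> falsifies M w G"
| "falsifies M w (Or F G) \<longleftrightarrow> falsifies M w F \<and> falsifies M w G"
| "falsifies M w (SNeg F) \<longleftrightarrow> verifies M w F"
| "falsifies M w (Box F) \<longleftrightarrow> (\<exists>u. (w, u) \<in> acc M \<and> falsifies M u F)"
| "falsifies M w (Dia F) \<longleftrightarrow> (\<forall>u. (w, u) \<in> acc M \<longrightarrow> falsifies M u F)"
| "falsifies M w (Forall x F) \<longleftrightarrow> (\<exists>a \<in> carr (pos M w). falsifies M w (subst1 x (Cst (Inr a)) F))"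
| "falsifies M w (Exists x F) \<longleftrightarrow> (\<forall>a \<in> carr (pos M w). falsifies M w (subst1 x (Cst (Inr a)) F))"
  by pat_completeness auto
termination
  by (relation "measure (\<lambda>z. case z of Inl (M, w, F) \<Rightarrow> size F | Inr (M, w, F) \<Rightarrow> size F)")
     (auto simp: subst1_def)

text \<open>HOL cannot quantify over types inside a formula, so the consequence relation is relative to
  the type \<open>'a\<close> of individuals and the type \<open>'w\<close> of worlds. Soundness is to hold for arbitrary
  \<open>'a\<close> and \<open>'w\<close>; for completeness it suffices that \<open>'a\<close> and \<open>'w\<close> are large enough to carry a canonical
  model, for instance formulas as individuals and sets of formulas as worlds.\<close>

definition entails ::
  "'a itself \<Rightarrow> 'w itself \<Rightarrow> ('p, 'c) signature \<Rightarrow> ('p, 'c) fm set \<Rightarrow> ('p, 'c) fm set \<Rightarrow> bool"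
where
  "entails _ _ \<sigma> \<Gamma> \<Delta> \<longleftrightarrow>
     (\<forall>(M :: ('p, 'c, 'a, 'w) model) w s.
        is_model \<sigma> M \<longrightarrow> w \<in> worlds M \<longrightarrow> is_subst \<sigma> (carr (pos M w)) s \<longrightarrow> ground s \<longrightarrow>
        (\<forall>F \<in> \<Gamma>. verifies M w (lift F)) \<longrightarrow>
        (\<exists>G \<in> \<Delta>. verifies M w (subst s (lift G))))"

end

theory Submission
  imports Defs
begin

text \<open>Completeness is a Henkin argument adapted to increasing domains. Worlds are pairs \<open>(n, w)\<close> of a
  level and a maximal consistent set that has witnesses for all its existential sentences among the
  constants of level at most \<open>n + 1\<close>; accessibility goes from level \<open>n\<close> to level \<open>n + 1\<close> only, so the
  witnesses of a successor are fresh with respect to the sentences inherited from its predecessor.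
  The witness of an existential formula is an injective code of that formula, and the Henkin axioms
  are conservative because the witness of largest size among finitely many of them occurs in none of
  the others. Strong negation needs no extra idea: the truth lemma is proved simultaneously for \<open>F\<close>
  and \<open>SNeg F\<close>. Provability of a formula in the extended language goes back to the original one by
  replacing constants with variables that exceed all variables of the derivation and ill-formed
  atoms with \<open>Bot\<close>.\<close>

section \<open>Formulas and substitution\<close>

lemma fm_induct [case_names Atom Bot Binary SNeg Modal Quantifier]:
  assumes "\<And>p ts. P (Atom p ts)"
    and "P Bot"
    and "\<And>C F G. C \<in> {Imp, And, Or} \<Longrightarrow> P F \<Longrightarrow> P G \<Longrightarrow> P (C F G)"
    and "\<And>F. P F \<Longrightarrow> P (SNeg F)"
    and "\<And>M F. M \<in> {Box, Dia} \<Longrightarrow> P F \<Longrightarrow> P (M F)"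
    and "\<And>Q x F. Q \<in> {Forall, Exists} \<Longrightarrow> P F \<Longrightarrow> P (Q x F)"
  shows "P F"
  using assms(3)[of Imp] assms(3)[of And] assms(3)[of Or] assms(5)[of Box] assms(5)[of Dia]
    assms(6)[of Forall] assms(6)[of Exists]
  by (induction F) (simp_all add: assms(1,2,4))

primrec all_vars :: "('p, 'c) fm \<Rightarrow> nat set" where
  "all_vars (Atom P ts) = (\<Union>t\<in>set ts. fv_tm t)"
| "all_vars Bot = {}"
| "all_vars (Imp F G) = all_vars F \<union> all_vars G"
| "all_vars (And F G) = all_vars F \<union> all_vars G"
| "all_vars (Or F G) = all_vars F \<union> all_vars G"
| "all_vars (SNeg F) = all_vars F"
| "all_vars (Box F) = all_vars F"
| "all_vars (Dia F) = all_vars F"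
| "all_vars (Forall x F) = insert x (all_vars F)"
| "all_vars (Exists x F) = insert x (all_vars F)"

lemma finite_fv_tm [simp]: "finite (fv_tm t)"
  by (cases t) auto

lemma finite_all_vars [simp]: "finite (all_vars F)"
  by (induction F) auto

lemma fv_subset_all_vars: "fv F \<subseteq> all_vars F"
  by (induction F) auto

lemma finite_fv: "finite (fv F)"
  using finite_subset[OF fv_subset_all_vars] by simp

lemma fv_map_fm: "fv (map_fm id f F) = fv F"
proof -
  have "fv_tm (map_tm f t) = fv_tm t" for t by (cases t) auto
  then show ?thesis by (induction F) auto
qed

lemma subst_tm_Var [simp]: "subst_tm Var t = t"
  by (cases t) auto

lemma subst_tm_cong: "(\<And>x. x \<in> fv_tm t \<Longrightarrow> s x = s' x) \<Longrightarrow> subst_tm s t = subst_tm s' t"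
  by (cases t) auto

lemma subst_cong: "(\<And>x. x \<in> fv F \<Longrightarrow> s x = s' x) \<Longrightarrow> subst s F = subst s' F"
proof (induction F arbitrary: s s' rule: fm_induct)
  case (Atom P ts)
  then show ?case by (auto intro!: subst_tm_cong)
next
  case (Binary C F G)
  from Binary.IH[of s s'] Binary.hyps Binary.prems show ?case by auto
next
  case (SNeg F)
  from SNeg.IH[of s s'] SNeg.prems show ?case by auto
next
  case (Modal M F)
  from Modal.IH[of s s'] Modal.hyps Modal.prems show ?case by auto
next
  case (Quantifier Q x F)
  have "subst (s(x := Var x)) F = subst (s'(x := Var x)) F"
    by (rule Quantifier.IH) (use Quantifier.hyps Quantifier.prems in auto)
  then show ?case using Quantifier.hyps by auto
qed simp

lemma subst_Var [simp]: "subst Var F = F"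
  by (induction F) (simp_all add: map_idI fun_upd_idem)

lemma subst_sentence: "fv F = {} \<Longrightarrow> subst s F = F"
  using subst_cong[of F s Var] by simp

lemma subst1_not_free: "x \<notin> fv F \<Longrightarrow> subst1 x t F = F"
  unfolding subst1_def by (subst subst_cong[of F _ Var]) auto

lemma subst1_Var_same [simp]: "subst1 x (Var x) F = F"
  by (simp add: subst1_def fun_upd_idem)

lemma subst1_simps [simp]:
  "subst1 x t Bot = Bot"
  "subst1 x t (Imp F G) = Imp (subst1 x t F) (subst1 x t G)"
  "subst1 x t (SNeg F) = SNeg (subst1 x t F)"
  by (simp_all add: subst1_def)

lemma free_for_Var_same: "free_for (Var x) x F"
  by (induction F) auto

lemma free_for_closed: "fv_tm t = {} \<Longrightarrow> free_for t x F"
  by (induction F) auto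

lemma subst_subst:
  assumes "\<And>x. s x = Var x \<or> fv_tm (s x) = {}"
  shows "subst s' (subst s F) = subst (\<lambda>x. subst_tm s' (s x)) F"
  using assms
proof (induction F arbitrary: s s' rule: fm_induct)
  case (Atom P ts)
  have "subst_tm s' (subst_tm s t) = subst_tm (\<lambda>x. subst_tm s' (s x)) t" for t
    by (cases t) auto
  then show ?case by simp
next
  case (Quantifier Q x F)
  have "subst_tm (s'(x := Var x)) (s y) = subst_tm s' (s y)" if "y \<noteq> x" for y
    by (rule subst_tm_cong) (use Quantifier.prems[of y] that in auto)
  then have "(\<lambda>y. subst_tm (s'(x := Var x)) ((s(x := Var x)) y)) = (\<lambda>y. subst_tm s' (s y))(x := Var x)"
    by auto
  moreover have "subst (s'(x := Var x)) (subst (s(x := Var x)) F) =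
      subst (\<lambda>y. subst_tm (s'(x := Var x)) ((s(x := Var x)) y)) F"
    by (rule Quantifier.IH) (use Quantifier.prems in auto)
  ultimately show ?case using Quantifier.hyps by auto
qed auto

lemma subst1_subst_closed:
  assumes "\<And>x. fv_tm (s x) = {}"
  shows "subst1 x t (subst (s(x := Var x)) F) = subst (s(x := t)) F"
proof -
  have "subst_tm (Var(x := t)) ((s(x := Var x)) y) = (s(x := t)) y" for y
    using assms[of y] by (cases "s y") auto
  then show ?thesis
    unfolding subst1_def using assms by (subst subst_subst) (auto simp: fun_upd_def)
qed

lemma fv_subst: "fv (subst s F) \<subseteq> (\<Union>x\<in>fv F. fv_tm (s x))"
proof (induction F arbitrary: s rule: fm_induct)
  case (Atom P ts)
  have "fv_tm (subst_tm s t) = (\<Union>x\<in>fv_tm t. fv_tm (s x))" for t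
    by (cases t) auto
  then show ?case by simp
next
  case (Binary C F G)
  have "fv (subst s F) \<union> fv (subst s G) \<subseteq> (\<Union>x\<in>fv F \<union> fv G. fv_tm (s x))"
    using Binary.IH[of s] by blast
  then show ?case using Binary.hyps by fastforce
next
  case (Quantifier Q x F)
  have "fv (subst (s(x := Var x)) F) \<subseteq> (\<Union>y\<in>fv F. fv_tm ((s(x := Var x)) y))"
    by (rule Quantifier.IH)
  then have "fv (subst (s(x := Var x)) F) - {x} \<subseteq> (\<Union>y\<in>fv F - {x}. fv_tm (s y))"
    by (fastforce split: if_splits)
  then show ?case using Quantifier.hyps by fastforce
qed fastforce+

lemma fv_subst1_closed: "fv_tm t = {} \<Longrightarrow> fv (subst1 x t F) \<subseteq> fv F - {x}"
  using fv_subst[of "Var(x := t)" F] by (auto simp: subst1_def split: if_splits)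

lemma set2_fm_subst: "set2_fm (subst s F) \<subseteq> set2_fm F \<union> (\<Union>x. set_tm (s x))"
proof (induction F arbitrary: s rule: fm_induct)
  case (Atom P ts)
  have "set_tm (subst_tm s t) \<subseteq> set_tm t \<union> (\<Union>x. set_tm (s x))" for t
    by (cases t) auto
  then show ?case by (auto 4 4)
next
  case (Binary C F G)
  have "set2_fm (subst s F) \<union> set2_fm (subst s G) \<subseteq>
      set2_fm F \<union> set2_fm G \<union> (\<Union>x. set_tm (s x))"
    using Binary.IH[of s] by blast
  then show ?case using Binary.hyps by fastforce
next
  case (Quantifier Q x F)
  have "set2_fm (subst (s(x := Var x)) F) \<subseteq> set2_fm F \<union> (\<Union>y. set_tm ((s(x := Var x)) y))"
    by (rule Quantifier.IH)
  also have "\<dots> \<subseteq> set2_fm F \<union> (\<Union>y. set_tm (s y))" by (auto split: if_splits)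
  finally show ?case using Quantifier.hyps by auto
qed fastforce+

text \<open>A quantifier over \<open>x\<close> turns the renaming of \<open>x\<close> into the identity, so the induction covers both.\<close>

lemma rename_fresh_inverse:
  fixes F :: "('p, 'c) fm"
  assumes "y \<notin> all_vars F" and "s = Var \<or> s = Var(x := Var y)"
  shows "subst (Var(y := Var x)) (subst s F) = F" and "free_for (Var x) y (subst s F)"
proof -
  have "subst (Var(y := Var x)) (subst s F) = F \<and> free_for (Var x) y (subst s F)"
    using assms
  proof (induction F arbitrary: s rule: fm_induct)
    case (Atom P ts)
    have "subst_tm (Var(y := Var x)) (subst_tm s t) = t" if "t \<in> set ts" for t
    proof -
      have "y \<notin> fv_tm t" using that Atom.prems(1) by auto
      then show ?thesis using Atom.prems(2) by (cases t) auto
    qed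
    then show ?case by (simp add: map_idI del: fun_upd_apply)
  next
    case (Binary C F G)
    from Binary.IH[of s] Binary.hyps Binary.prems show ?case by (auto simp del: fun_upd_apply)
  next
    case (Modal M F)
    from Modal.IH[of s] Modal.hyps Modal.prems show ?case by (auto simp del: fun_upd_apply)
  next
    case (Quantifier Q z F)
    have z: "z \<noteq> y" and F: "y \<notin> all_vars F" using Quantifier by auto
    have "s(z := Var z) = Var \<or> z \<noteq> x \<and> s(z := Var z) = Var(x := Var y)"
      using Quantifier.prems(2) by (auto simp: fun_eq_iff)
    moreover have "(Var :: nat \<Rightarrow> 'c tm)(y := Var x, z := Var z) = Var(y := Var x)"
      using z by (auto simp: fun_eq_iff)
    moreover have "y \<notin> fv F" using F fv_subset_all_vars by blast
    ultimately show ?case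
      using Quantifier.IH[of "s(z := Var z)"] Quantifier.hyps F by (auto simp del: fun_upd_apply)
  qed simp_all
  then show "subst (Var(y := Var x)) (subst s F) = F" and "free_for (Var x) y (subst s F)" by simp_all
qed

lemma subst1_fresh_inverse: "y \<notin> all_vars F \<Longrightarrow> subst1 y (Var x) (subst1 x (Var y) F) = F"
  by (simp add: subst1_def rename_fresh_inverse(1))

lemma free_for_fresh_inverse: "y \<notin> all_vars F \<Longrightarrow> free_for (Var x) y (subst1 x (Var y) F)"
  by (simp add: subst1_def rename_fresh_inverse(2))

lemma in_Tm_if_wf_subst1:
  assumes "x \<in> fv F" and "wf_fm \<sigma> (subst1 x t F)"
  shows "t \<in> Tm \<sigma>"
proof -
  have "s x \<in> Tm \<sigma>" if "wf_fm \<sigma> (subst s F)" for s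
    using assms(1) that
  proof (induction F arbitrary: s rule: fm_induct)
    case (Atom P ts)
    then obtain t' where t': "t' \<in> set ts" "x \<in> fv_tm t'" by auto
    from t'(2) have "t' = Var x" by (cases t') auto
    then show ?case using Atom.prems(2) t'(1) by (auto simp: image_subset_iff)
  next
    case (Quantifier Q y F)
    then have "(s(y := Var y)) x \<in> Tm \<sigma>" by (intro Quantifier.IH) (auto simp del: fun_upd_apply)
    then show ?case using Quantifier.hyps Quantifier.prems(1) by auto
  qed auto
  from this[of "Var(x := t)"] show ?thesis using assms(2) by (simp add: subst1_def)
qed

lemma foldr_Imp_simps:
  "fv (foldr Imp Fs G) = (\<Union>F\<in>set Fs. fv F) \<union> fv G"
  "set2_fm (foldr Imp Fs G) = (\<Union>F\<in>set Fs. set2_fm F) \<union> set2_fm G"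
  "wf_fm \<sigma> (foldr Imp Fs G) \<longleftrightarrow> (\<forall>F\<in>set Fs. wf_fm \<sigma> F) \<and> wf_fm \<sigma> G"
  "subst s (foldr Imp Fs G) = foldr Imp (map (subst s) Fs) (subst s G)"
  "map_fm id f (foldr Imp Fs G) = foldr Imp (map (map_fm id f) Fs) (map_fm id f G)"
  by (induction Fs) auto

section \<open>Soundness\<close>

fun val :: "('p, 'c, 'a) struct \<Rightarrow> (nat \<Rightarrow> 'a) \<Rightarrow> 'c tm \<Rightarrow> 'a" where
  "val \<AA> e (Var x) = e x"
| "val \<AA> e (Cst c) = cint \<AA> c"

definition struct_of :: "('p, 'c, 'a, 'w) model \<Rightarrow> bool \<Rightarrow> 'w \<Rightarrow> ('p, 'c, 'a) struct" where
  "struct_of M b w = (if b then pos M w else neg M w)"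

lemma struct_of_simps [simp]: "struct_of M True w = pos M w" "struct_of M False w = neg M w"
  by (simp_all add: struct_of_def)

text \<open>\<open>b\<close> selects verification (\<open>True\<close>) or falsification (\<open>False\<close>). Environments replace the
  substitution of constants naming individuals.\<close>

primrec satisfies ::
  "('p, 'c, 'a, 'w) model \<Rightarrow> bool \<Rightarrow> 'w \<Rightarrow> (nat \<Rightarrow> 'a) \<Rightarrow> ('p, 'c) fm \<Rightarrow> bool"
where
  "satisfies M b w e (Atom P ts) \<longleftrightarrow> map (val (struct_of M b w) e) ts \<in> pint (struct_of M b w) P"
| "satisfies M b w e Bot \<longleftrightarrow> \<not> b"
| "satisfies M b w e (Imp F G) \<longleftrightarrow>
     (if b then satisfies M True w e F \<longrightarrow> satisfies M True w e G
      else satisfies M True w e F \<and> satisfies M False w e G)"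
| "satisfies M b w e (And F G) \<longleftrightarrow>
     (if b then satisfies M True w e F \<and> satisfies M True w e G
      else satisfies M False w e F \<or> satisfies M False w e G)"
| "satisfies M b w e (Or F G) \<longleftrightarrow>
     (if b then satisfies M True w e F \<or> satisfies M True w e G
      else satisfies M False w e F \<and> satisfies M False w e G)"
| "satisfies M b w e (SNeg F) \<longleftrightarrow> satisfies M (\<not> b) w e F"
| "satisfies M b w e (Box F) \<longleftrightarrow>
     (if b then \<forall>u. (w, u) \<in> acc M \<longrightarrow> satisfies M True u e F
      else \<exists>u. (w, u) \<in> acc M \<and> satisfies M False u e F)"
| "satisfies M b w e (Dia F) \<longleftrightarrow>
     (if b then \<exists>u. (w, u) \<in> acc M \<and> satisfies M True u e F
      else \<forall>u. (w, u) \<in> acc M \<longrightarrow> satisfies M False u e F)"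
| "satisfies M b w e (Forall x F) \<longleftrightarrow>
     (if b then \<forall>a\<in>carr (pos M w). satisfies M True w (e(x := a)) F
      else \<exists>a\<in>carr (pos M w). satisfies M False w (e(x := a)) F)"
| "satisfies M b w e (Exists x F) \<longleftrightarrow>
     (if b then \<exists>a\<in>carr (pos M w). satisfies M True w (e(x := a)) F
      else \<forall>a\<in>carr (pos M w). satisfies M False w (e(x := a)) F)"

lemma satisfies_disjunction:
  "satisfies M True w e (disjunction Fs) \<longleftrightarrow> (\<exists>F\<in>set Fs. satisfies M True w e F)"
  by (induction Fs rule: disjunction.induct) auto

lemma val_cong: "(\<And>x. x \<in> fv_tm t \<Longrightarrow> e x = e' x) \<Longrightarrow> val \<AA> e t = val \<AA> e' t"
  by (cases t) auto

lemma val_subst_tm: "val \<AA> e (subst_tm (Var(x := t)) t') = val \<AA> (e(x := val \<AA> e t)) t'"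
  by (cases t') auto

lemma satisfies_cong:
  assumes "\<And>x. x \<in> fv F \<Longrightarrow> e x = e' x"
  shows "satisfies M b w e F \<longleftrightarrow> satisfies M b w e' F"
  using assms
proof (induction F arbitrary: b w e e' rule: fm_induct)
  case (Atom P ts)
  then have "map (val (struct_of M b w) e) ts = map (val (struct_of M b w) e') ts"
    by (auto intro!: val_cong)
  then show ?case by (simp only: satisfies.simps)
next
  case (Binary C F G)
  from Binary.IH[of e e'] Binary.hyps Binary.prems show ?case by auto
next
  case (SNeg F)
  from SNeg.IH[of e e'] SNeg.prems show ?case by auto
next
  case (Modal M F)
  from Modal.IH[of e e'] Modal.hyps Modal.prems show ?case by auto
next
  case (Quantifier Q x F)
  have "satisfies M b w (e(x := a)) F \<longleftrightarrow> satisfies M b w (e'(x := a)) F" for a b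
    by (rule Quantifier.IH) (use Quantifier.hyps Quantifier.prems in auto)
  then show ?case using Quantifier.hyps by auto
qed simp

lemma satisfies_fun_upd_not_free:
  "x \<notin> fv F \<Longrightarrow> satisfies M b w (e(x := a)) F \<longleftrightarrow> satisfies M b w e F"
  by (rule satisfies_cong) auto

definition valid_at :: "('p, 'c, 'a, 'w) model \<Rightarrow> 'w \<Rightarrow> ('p, 'c) fm \<Rightarrow> bool" where
  "valid_at M w F \<longleftrightarrow> (\<forall>e. range e \<subseteq> carr (pos M w) \<longrightarrow> satisfies M True w e F)"

lemma valid_at_fun_upd:
  "valid_at M w F \<Longrightarrow> range e \<subseteq> carr (pos M w) \<Longrightarrow> a \<in> carr (pos M w) \<Longrightarrow> satisfies M True w (e(x := a)) F"
  unfolding valid_at_def by (erule allE[of _ "e(x := a)"]) auto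

lemma valid_at_MP: "valid_at M w F \<Longrightarrow> valid_at M w (Imp F G) \<Longrightarrow> valid_at M w G"
  by (simp add: valid_at_def)

lemma valid_at_Forall:
  fixes M :: "('p, 'c, 'a, 'w) model"
  assumes "valid_at M w (Imp F G)" and "x \<notin> fv F"
  shows "valid_at M w (Imp F (Forall x G))"
  unfolding valid_at_def
proof (intro allI impI)
  fix e :: "nat \<Rightarrow> 'a"
  assume e: "range e \<subseteq> carr (pos M w)"
  have "satisfies M True w (e(x := a)) (Imp F G)" if "a \<in> carr (pos M w)" for a
    by (rule valid_at_fun_upd[OF assms(1) e that])
  then show "satisfies M True w e (Imp F (Forall x G))"
    using assms(2) by (auto simp: satisfies_fun_upd_not_free)
qed

lemma valid_at_Exists:
  fixes M :: "('p, 'c, 'a, 'w) model"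
  assumes "valid_at M w (Imp F G)" and "x \<notin> fv G"
  shows "valid_at M w (Imp (Exists x F) G)"
  unfolding valid_at_def
proof (intro allI impI)
  fix e :: "nat \<Rightarrow> 'a"
  assume e: "range e \<subseteq> carr (pos M w)"
  have "satisfies M True w (e(x := a)) (Imp F G)" if "a \<in> carr (pos M w)" for a
    by (rule valid_at_fun_upd[OF assms(1) e that])
  then show "satisfies M True w e (Imp (Exists x F) G)"
    using assms(2) by (auto simp: satisfies_fun_upd_not_free)
qed

lemma subst_lift_sentence: "F \<in> Sent \<sigma> \<Longrightarrow> subst s (lift F) = lift F"
  by (simp add: Sent_def lift_def fv_map_fm subst_sentence)

lemma ground_subst_iff: "is_subst \<sigma> A s \<and> ground s \<longleftrightarrow> range s \<subseteq> Cst ` (csts \<sigma> <+> A)"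
proof -
  have "s x \<in> Tm (sig_ext \<sigma> A) \<and> (\<exists>c. s x = Cst c) \<longleftrightarrow> s x \<in> Cst ` (csts \<sigma> <+> A)" for x
    by (cases "s x") (auto simp: Tm_def sig_ext_def)
  then show ?thesis by (simp add: is_subst_def ground_def image_subset_iff flip: all_conj_distrib)
qed

lemma fv_tm_range_Cst: "range s \<subseteq> Cst ` C \<Longrightarrow> fv_tm (s x) = {}"
  by (drule subsetD[OF _ rangeI[of s x]]) auto

definition env_of :: "('p, 'c, 'a, 'w) model \<Rightarrow> 'w \<Rightarrow> (nat \<Rightarrow> ('c + 'a) tm) \<Rightarrow> nat \<Rightarrow> 'a" where
  "env_of M w s = (\<lambda>x. tm_val (pos M w) (s x))"

lemma env_of_fun_upd: "env_of M w (s(x := Cst (Inr a))) = (env_of M w s)(x := a)"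
  by (auto simp: env_of_def)

definition forces :: "('p, 'c, 'a, 'w) model \<Rightarrow> bool \<Rightarrow> 'w \<Rightarrow> ('p, 'c + 'a) fm \<Rightarrow> bool" where
  "forces M b w F = (if b then verifies M w F else falsifies M w F)"

lemma forces_simps [simp]: "forces M True w F = verifies M w F" "forces M False w F = falsifies M w F"
  by (simp_all add: forces_def)

context
  fixes \<sigma> :: "('p, 'c) signature" and M :: "('p, 'c, 'a, 'w) model"
  assumes model: "is_model \<sigma> M"
begin

lemma acc_world: "(w, u) \<in> acc M \<Longrightarrow> u \<in> worlds M"
  using model unfolding is_model_def by blast

lemma carr_acc: "(w, u) \<in> acc M \<Longrightarrow> carr (pos M w) \<subseteq> carr (pos M u)"
  using model unfolding is_model_def by blast

lemma val_acc: "(w, u) \<in> acc M \<Longrightarrow> t \<in> Tm \<sigma> \<Longrightarrow> val (pos M u) e t = val (pos M w) e t"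
  using model unfolding is_model_def by (cases t) (fastforce simp: Tm_def)+

lemma val_struct_of: "w \<in> worlds M \<Longrightarrow> t \<in> Tm \<sigma> \<Longrightarrow> val (struct_of M b w) e t = val (pos M w) e t"
  using model unfolding is_model_def by (cases t; cases b) (auto simp: Tm_def)

lemma val_in_carr:
  "w \<in> worlds M \<Longrightarrow> range e \<subseteq> carr (pos M w) \<Longrightarrow> t \<in> Tm \<sigma> \<Longrightarrow> val (pos M w) e t \<in> carr (pos M w)"
  using model unfolding is_model_def is_struct_def by (cases t) (auto simp: Tm_def)

lemma env_of_acc:
  assumes "(w, u) \<in> acc M" and "range s \<subseteq> Cst ` (csts \<sigma> <+> A)"
  shows "env_of M u s = env_of M w s"
proof
  fix x
  obtain c where "c \<in> csts \<sigma> <+> A" "s x = Cst c" using assms(2) by blast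
  then show "env_of M u s x = env_of M w s x"
    using val_acc[OF assms(1), of "Cst _"] by (cases c) (auto simp: env_of_def Tm_def)
qed

lemma range_env_of:
  assumes "w \<in> worlds M" and "range s \<subseteq> Cst ` (csts \<sigma> <+> carr (pos M w))"
  shows "range (env_of M w s) \<subseteq> carr (pos M w)"
proof clarify
  fix x
  obtain c where "c \<in> csts \<sigma> <+> carr (pos M w)" "s x = Cst c" using assms(2) by blast
  then show "env_of M w s x \<in> carr (pos M w)"
    using assms(1) model by (cases c) (auto simp: env_of_def is_model_def is_struct_def)
qed

lemma tm_val_subst_lift:
  assumes "w \<in> worlds M" and "range s \<subseteq> Cst ` (csts \<sigma> <+> A)" and "t \<in> Tm \<sigma>"
  shows "tm_val (struct_of M b w) (subst_tm s (map_tm Inl t)) = val (struct_of M b w) (env_of M w s) t"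
proof (cases t)
  case (Var x)
  obtain c where "c \<in> csts \<sigma> <+> A" "s x = Cst c" using assms(2) by blast
  then show ?thesis
    using Var val_struct_of[OF assms(1), of "Cst _"] by (cases c) (auto simp: env_of_def Tm_def)
qed simp

lemma forces_subst_lift:
  assumes "w \<in> worlds M" and "range s \<subseteq> Cst ` (csts \<sigma> <+> carr (pos M w))" and "wf_fm \<sigma> F"
  shows "forces M b w (subst s (lift F)) \<longleftrightarrow> satisfies M b w (env_of M w s) F"
  using assms
proof (induction F arbitrary: b w s rule: fm_induct)
  case (Atom P ts)
  then have "map (\<lambda>t. tm_val (struct_of M b w) (subst_tm s (map_tm Inl t))) ts =
      map (val (struct_of M b w) (env_of M w s)) ts"
    using tm_val_subst_lift[OF Atom.prems(1,2)] by auto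
  then show ?case by (cases b) (simp_all add: lift_def comp_def del: map_eq_conv)
next
  case (Binary C F G)
  from Binary.IH[of w s True] Binary.IH[of w s False] Binary.hyps Binary.prems show ?case
    by (auto simp: lift_def forces_def)
next
  case (SNeg F)
  from SNeg.IH[of w s "\<not> b"] SNeg.prems show ?case by (auto simp: lift_def forces_def)
next
  case (Modal N F)
  have "range s \<subseteq> Cst ` (csts \<sigma> <+> carr (pos M u))" if "(w, u) \<in> acc M" for u
    using Modal.prems(2) carr_acc[OF that] by fast
  then have "forces M b u (subst s (lift F)) \<longleftrightarrow> satisfies M b u (env_of M w s) F"
    if "(w, u) \<in> acc M" for b u
    unfolding env_of_acc[OF that Modal.prems(2), symmetric]
    using Modal.hyps Modal.prems(3) acc_world that by (intro Modal.IH) auto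
  from this[of _ True] this[of _ False] show ?case
    using Modal.hyps by (auto simp: lift_def forces_def cong: conj_cong)
next
  case (Quantifier Q x F)
  have "forces M b w (subst (s(x := Cst (Inr a))) (lift F)) \<longleftrightarrow>
      satisfies M b w ((env_of M w s)(x := a)) F" if "a \<in> carr (pos M w)" for a b
    unfolding env_of_fun_upd[symmetric]
    using Quantifier.hyps Quantifier.prems that by (intro Quantifier.IH) auto
  from this[of _ True] this[of _ False] show ?case
    using Quantifier.hyps
    by (auto simp: lift_def forces_def subst1_subst_closed fv_tm_range_Cst[OF Quantifier.prems(2)]
        simp del: fun_upd_apply)
qed (simp add: lift_def forces_def)

lemma verifies_subst_lift:
  assumes "w \<in> worlds M" and "range s \<subseteq> Cst ` (csts \<sigma> <+> carr (pos M w))" and "F \<in> Form \<sigma>"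
  shows "verifies M w (subst s (lift F)) \<longleftrightarrow> satisfies M True w (env_of M w s) F"
  using forces_subst_lift[of w s F True] assms by (simp add: Form_def)

lemma satisfies_subst1:
  assumes "t \<in> Tm \<sigma>" and "w \<in> worlds M" and "free_for t x F"
  shows "satisfies M b w e (subst1 x t F) \<longleftrightarrow> satisfies M b w (e(x := val (pos M w) e t)) F"
  using assms(2-)
proof (induction F arbitrary: b w e rule: fm_induct)
  case (Atom P ts)
  show ?case
    using val_struct_of[OF Atom.prems(1) assms(1), of b e]
    by (simp add: subst1_def comp_def val_subst_tm del: fun_upd_apply)
next
  case (Modal N F)
  have "satisfies M b u e (subst1 x t F) \<longleftrightarrow> satisfies M b u (e(x := val (pos M w) e t)) F"
    if "(w, u) \<in> acc M" for u b
    using Modal.IH[OF acc_world[OF that]] Modal.hyps Modal.prems(2) val_acc[OF that assms(1)]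
    by (auto simp del: fun_upd_apply)
  then show ?case using Modal.hyps by (auto simp: subst1_def simp del: fun_upd_apply cong: conj_cong)
next
  case (Quantifier Q y F)
  show ?case
  proof (cases "x \<in> fv (Q y F)")
    case True
    then have "x \<noteq> y" and y: "y \<notin> fv_tm t" and free: "free_for t x F"
      using Quantifier by auto
    have "val (pos M w) (e(y := a)) t = val (pos M w) e t" for a
      by (rule val_cong) (use y in auto)
    then have "satisfies M b w (e(y := a)) (subst1 x t F) \<longleftrightarrow>
        satisfies M b w ((e(x := val (pos M w) e t))(y := a)) F" for a b
      using Quantifier.IH[OF Quantifier.prems(1) free] \<open>x \<noteq> y\<close>
      by (simp add: fun_upd_twist del: fun_upd_apply)
    moreover have "(Var(x := t))(y := Var y) = Var(x := t)" using \<open>x \<noteq> y\<close> by auto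
    ultimately show ?thesis
      using Quantifier.hyps by (auto simp: subst1_def simp del: fun_upd_apply)
  next
    case False
    then show ?thesis by (simp only: subst1_not_free satisfies_fun_upd_not_free not_False_eq_True)
  qed
qed (auto simp: subst1_def)

lemma satisfies_instance:
  assumes w: "w \<in> worlds M" and e: "range e \<subseteq> carr (pos M w)"
    and "free_for t x F" and "wf_fm \<sigma> (subst1 x t F)"
  obtains a where "a \<in> carr (pos M w)"
    and "satisfies M b w e (subst1 x t F) \<longleftrightarrow> satisfies M b w (e(x := a)) F"
proof (cases "x \<in> fv F")
  case True
  then have t: "t \<in> Tm \<sigma>" using in_Tm_if_wf_subst1 assms(4) by blast
  then show ?thesis using that val_in_carr[OF w e t] satisfies_subst1[OF t w assms(3)] by blast
next
  case False
  have "e x \<in> carr (pos M w)" and "e(x := e x) = e" using e by auto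
  then show ?thesis using that[of "e x"] False by (simp add: subst1_not_free)
qed

lemma valid_at_axiom:
  assumes w: "w \<in> worlds M" and "axiom F" and "wf_fm \<sigma> F"
  shows "valid_at M w F"
proof -
  have "satisfies M True w e F" if e: "range e \<subseteq> carr (pos M w)" for e
    using assms(2,3) by cases (auto elim: satisfies_instance[OF w e, where b = True])
  then show ?thesis by (simp add: valid_at_def)
qed

lemma valid_at_Box_Dia:
  assumes "\<And>u. (w, u) \<in> acc M \<Longrightarrow> valid_at M u (Imp F G)"
  shows "valid_at M w (Imp (Box F) (Box G))" and "valid_at M w (Imp (Dia F) (Dia G))"
proof -
  have "satisfies M True u e F \<longrightarrow> satisfies M True u e G"
    if "range e \<subseteq> carr (pos M w)" "(w, u) \<in> acc M" for u e
    using assms[OF that(2)] carr_acc[OF that(2)] that(1) by (auto simp: valid_at_def)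
  then show "valid_at M w (Imp (Box F) (Box G))" and "valid_at M w (Imp (Dia F) (Dia G))"
    by (auto simp: valid_at_def)
qed

lemma valid_at_QBK: "F \<in> QBK \<sigma> \<Longrightarrow> w \<in> worlds M \<Longrightarrow> valid_at M w F"
proof (induction arbitrary: w rule: QBK.induct)
  case (Ax F)
  then show ?case by (simp add: valid_at_axiom Form_def)
next
  case (MB F G)
  then show ?case by (simp add: valid_at_Box_Dia(1) acc_world)
next
  case (MD F G)
  then show ?case by (simp add: valid_at_Box_Dia(2) acc_world)
qed (auto intro: valid_at_MP valid_at_Forall valid_at_Exists)

lemma valid_at_consequences:
  assumes "F \<in> consequences \<sigma> \<Gamma>" and "w \<in> worlds M" and "\<And>G. G \<in> \<Gamma> \<Longrightarrow> valid_at M w G"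
  shows "valid_at M w F"
  using assms
  by (induction rule: consequences.induct)
    (auto intro: valid_at_QBK valid_at_MP valid_at_Forall valid_at_Exists)

end

theorem soundness:
  fixes \<sigma> :: "('p, 'c) signature"
  assumes \<Gamma>: "\<Gamma> \<subseteq> Sent \<sigma>" and \<Delta>: "\<Delta> \<subseteq> Form \<sigma>" and "derives \<sigma> \<Gamma> \<Delta>"
  shows "entails TYPE('a) TYPE('w) \<sigma> \<Gamma> \<Delta>"
  unfolding entails_def
proof (intro allI impI)
  fix M :: "('p, 'c, 'a, 'w) model" and w s
  assume M: "is_model \<sigma> M" and w: "w \<in> worlds M" and "is_subst \<sigma> (carr (pos M w)) s" "ground s"
    and ver: "\<forall>F\<in>\<Gamma>. verifies M w (lift F)"
  then have s: "range s \<subseteq> Cst ` (csts \<sigma> <+> carr (pos M w))" using ground_subst_iff by blast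
  let ?e = "env_of M w s"
  have "valid_at M w F" if "F \<in> \<Gamma>" for F
  proof -
    have F: "F \<in> Sent \<sigma>" "F \<in> Form \<sigma>" "fv F = {}" using that \<Gamma> by (auto simp: Sent_def)
    have "verifies M w (subst s (lift F))" using ver that F(1) by (simp add: subst_lift_sentence)
    then have "satisfies M True w ?e F" using verifies_subst_lift[OF M w s F(2)] by simp
    then have "satisfies M True w e' F" for e' using satisfies_cong[of F e' ?e M] F(3) by simp
    then show ?thesis by (simp add: valid_at_def)
  qed
  moreover obtain Fs where Fs: "set Fs \<subseteq> \<Delta>" "disjunction Fs \<in> consequences \<sigma> \<Gamma>"
    using assms(3) by (auto simp: derives_def Disj_def)
  ultimately have "valid_at M w (disjunction Fs)" using valid_at_consequences[OF M] w by blast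
  then have "satisfies M True w ?e (disjunction Fs)"
    using range_env_of[OF M w s] by (simp add: valid_at_def)
  then show "\<exists>G\<in>\<Delta>. verifies M w (subst s (lift G))"
    using Fs(1) \<Delta> verifies_subst_lift[OF M w s] unfolding satisfies_disjunction by blast
qed

section \<open>Replacing constants by terms in derivations\<close>

text \<open>With \<open>A = UNIV\<close> no well-formedness has to be tracked.\<close>

inductive provable :: "('p, 'c) fm set \<Rightarrow> ('p, 'c) fm \<Rightarrow> bool" for A where
  Ax: "axiom F \<Longrightarrow> F \<in> A \<Longrightarrow> provable A F"
| MP: "provable A F \<Longrightarrow> provable A (Imp F G) \<Longrightarrow> provable A G"
| MB: "provable A (Imp F G) \<Longrightarrow> provable A (Imp (Box F) (Box G))"
| MD: "provable A (Imp F G) \<Longrightarrow> provable A (Imp (Dia F) (Dia G))"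
| BR1: "provable A (Imp F G) \<Longrightarrow> x \<notin> fv F \<Longrightarrow> provable A (Imp F (Forall x G))"
| BR2: "provable A (Imp F G) \<Longrightarrow> x \<notin> fv G \<Longrightarrow> provable A (Imp (Exists x F) G)"

lemma QBK_iff_provable: "F \<in> QBK \<sigma> \<longleftrightarrow> provable (Form \<sigma>) F"
proof
  show "F \<in> QBK \<sigma> \<Longrightarrow> provable (Form \<sigma>) F"
    by (induction rule: QBK.induct) (auto intro: provable.intros)
  show "provable (Form \<sigma>) F \<Longrightarrow> F \<in> QBK \<sigma>"
    by (induction rule: provable.induct) (auto intro: QBK.intros)
qed

lemma provable_mono: "provable A F \<Longrightarrow> A \<subseteq> B \<Longrightarrow> provable B F"
  by (induction rule: provable.induct) (auto intro: provable.intros)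

lemma provable_axiom: "axiom F \<Longrightarrow> provable UNIV F"
  by (rule provable.Ax) simp_all

primrec translate_tm :: "('c \<Rightarrow> 'd tm) \<Rightarrow> 'c tm \<Rightarrow> 'd tm" where
  "translate_tm \<kappa> (Var x) = Var x"
| "translate_tm \<kappa> (Cst c) = \<kappa> c"

primrec translate :: "('p \<Rightarrow> nat \<Rightarrow> bool) \<Rightarrow> ('c \<Rightarrow> 'd tm) \<Rightarrow> ('p, 'c) fm \<Rightarrow> ('p, 'd) fm" where
  "translate ok \<kappa> (Atom P ts) = (if ok P (length ts) then Atom P (map (translate_tm \<kappa>) ts) else Bot)"
| "translate ok \<kappa> Bot = Bot"
| "translate ok \<kappa> (Imp F G) = Imp (translate ok \<kappa> F) (translate ok \<kappa> G)"
| "translate ok \<kappa> (And F G) = And (translate ok \<kappa> F) (translate ok \<kappa> G)"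
| "translate ok \<kappa> (Or F G) = Or (translate ok \<kappa> F) (translate ok \<kappa> G)"
| "translate ok \<kappa> (SNeg F) = SNeg (translate ok \<kappa> F)"
| "translate ok \<kappa> (Box F) = Box (translate ok \<kappa> F)"
| "translate ok \<kappa> (Dia F) = Dia (translate ok \<kappa> F)"
| "translate ok \<kappa> (Forall x F) = Forall x (translate ok \<kappa> F)"
| "translate ok \<kappa> (Exists x F) = Exists x (translate ok \<kappa> F)"

lemma fv_translate: "fv (translate ok \<kappa> F) \<subseteq> fv F \<union> (\<Union>c\<in>set2_fm F. fv_tm (\<kappa> c))"
proof (induction F)
  case (Atom P ts)
  have "fv_tm (translate_tm \<kappa> t) \<subseteq> fv_tm t \<union> (\<Union>c\<in>set_tm t. fv_tm (\<kappa> c))" for t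
    by (cases t) auto
  then show ?case by simp blast
qed auto

lemma translate_subst:
  assumes "\<And>c y. c \<in> set2_fm F \<Longrightarrow> y \<in> fv_tm (\<kappa> c) \<Longrightarrow> s y = Var y"
  shows "translate ok \<kappa> (subst s F) = subst (\<lambda>y. translate_tm \<kappa> (s y)) (translate ok \<kappa> F)"
  using assms
proof (induction F arbitrary: s rule: fm_induct)
  case (Atom P ts)
  have "translate_tm \<kappa> (subst_tm s t) = subst_tm (\<lambda>y. translate_tm \<kappa> (s y)) (translate_tm \<kappa> t)"
    if "t \<in> set ts" for t
  proof (cases t)
    case (Cst c)
    then have "subst_tm (\<lambda>y. translate_tm \<kappa> (s y)) (\<kappa> c) = subst_tm Var (\<kappa> c)"
      by (intro subst_tm_cong) (use Atom.prems that in fastforce)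
    then show ?thesis using Cst by simp
  qed simp
  then show ?case by auto
next
  case (Binary C F G)
  from Binary.hyps show ?case by (auto intro!: Binary.IH Binary.prems)
next
  case (Quantifier Q x F)
  have "translate ok \<kappa> (subst (s(x := Var x)) F) =
      subst (\<lambda>y. translate_tm \<kappa> ((s(x := Var x)) y)) (translate ok \<kappa> F)"
    by (rule Quantifier.IH) (use Quantifier.hyps Quantifier.prems in auto)
  moreover have "(\<lambda>y. translate_tm \<kappa> ((s(x := Var x)) y)) = (\<lambda>y. translate_tm \<kappa> (s y))(x := Var x)"
    by auto
  ultimately show ?case using Quantifier.hyps by (auto simp del: fun_upd_apply)
qed auto

lemma translate_subst1:
  assumes "\<And>c. c \<in> set2_fm F \<Longrightarrow> x \<notin> fv_tm (\<kappa> c)"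
  shows "translate ok \<kappa> (subst1 x t F) = subst1 x (translate_tm \<kappa> t) (translate ok \<kappa> F)"
proof -
  have "translate ok \<kappa> (subst (Var(x := t)) F) =
      subst (\<lambda>y. translate_tm \<kappa> ((Var(x := t)) y)) (translate ok \<kappa> F)"
    by (rule translate_subst) (use assms in fastforce)
  moreover have "(\<lambda>y. translate_tm \<kappa> ((Var(x := t)) y)) = Var(x := translate_tm \<kappa> t)" by auto
  ultimately show ?thesis by (simp only: subst1_def)
qed

lemma free_for_translate:
  assumes "\<And>c. fv_tm (\<kappa> c) \<inter> insert x (all_vars F) = {}" and "free_for t x F"
  shows "free_for (translate_tm \<kappa> t) x (translate ok \<kappa> F)"
  using assms
proof (induction F rule: fm_induct)
  case (Quantifier Q y F)
  have "x \<notin> fv (translate ok \<kappa> (Q y F))" if "x \<notin> fv (Q y F)"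
    using that fv_translate[of ok \<kappa> "Q y F"] Quantifier.prems(1) by blast
  moreover have "y \<notin> fv_tm (translate_tm \<kappa> t)" if "y \<notin> fv_tm t"
    using that Quantifier.hyps Quantifier.prems(1) by (cases t) auto
  ultimately show ?case using Quantifier by auto
qed (auto simp: Int_Un_distrib)

lemma axiom_translate:
  assumes "axiom F" and "\<And>c. fv_tm (\<kappa> c) \<inter> all_vars F = {}"
  shows "axiom (translate ok \<kappa> F)"
  using assms
  by cases (auto simp: translate_subst1 intro!: axiom.intros free_for_translate)

definition variables_from :: "nat \<Rightarrow> ('c \<Rightarrow> 'd tm) \<Rightarrow> bool" where
  "variables_from N \<kappa> \<longleftrightarrow> (\<forall>c. fv_tm (\<kappa> c) \<subseteq> {N..})"

lemma eventually_greater: "finite X \<Longrightarrow> \<forall>\<^sub>F N :: nat in sequentially. \<forall>x\<in>X. x < N"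
  by (intro eventually_ball_finite ballI eventually_gt_at_top)

lemma eventually_variables_from_disjoint:
  assumes "finite X"
  shows "\<forall>\<^sub>F N in sequentially. \<forall>\<kappa>. variables_from N \<kappa> \<longrightarrow> (\<forall>c. fv_tm (\<kappa> c) \<inter> X = {})"
  using eventually_greater[OF assms] by eventually_elim (fastforce simp: variables_from_def)

text \<open>Capture is avoided because \<open>N\<close> is chosen after the derivation.\<close>

lemma provable_translate:
  assumes "provable A F"
  shows "\<forall>\<^sub>F N in sequentially. \<forall>\<kappa> :: 'c \<Rightarrow> 'd tm. variables_from N \<kappa> \<longrightarrow>
    range (translate ok \<kappa>) \<subseteq> B \<longrightarrow> provable B (translate ok \<kappa> F)"
  using assms
proof induction
  case (Ax F)
  from eventually_variables_from_disjoint[OF finite_all_vars[of F]] show ?case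
    by eventually_elim (use Ax in \<open>auto intro!: provable.Ax axiom_translate\<close>)
next
  case (MP F G)
  from MP.IH show ?case
    by eventually_elim (auto intro: provable.MP)
next
  case (MB F G)
  from MB.IH show ?case
    by eventually_elim (simp add: provable.MB)
next
  case (MD F G)
  from MD.IH show ?case
    by eventually_elim (simp add: provable.MD)
next
  case (BR1 F G x)
  from BR1.IH eventually_variables_from_disjoint[of "{x}", simplified] show ?case
    by eventually_elim (use BR1.hyps(2) fv_translate[of ok _ F] in \<open>force intro!: provable.BR1\<close>)
next
  case (BR2 F G x)
  from BR2.IH eventually_variables_from_disjoint[of "{x}", simplified] show ?case
    by eventually_elim (use BR2.hyps(2) fv_translate[of ok _ G] in \<open>force intro!: provable.BR2\<close>)
qed

lemma translate_id:
  assumes "\<And>c. c \<in> set2_fm F \<Longrightarrow> \<kappa> c = Cst c"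
  shows "translate (\<lambda>_ _. True) \<kappa> F = F"
  using assms
proof (induction F)
  case (Atom P ts)
  have "translate_tm \<kappa> t = t" if "t \<in> set ts" for t
    using Atom that by (cases t) force+
  then show ?case by (simp add: map_idI)
qed auto

definition has_arity :: "('p, 'c) signature \<Rightarrow> 'p \<Rightarrow> nat \<Rightarrow> bool" where
  "has_arity \<sigma> P n \<longleftrightarrow> P \<in> preds \<sigma> \<and> arity \<sigma> P = n"

lemma translate_map_fm:
  assumes "wf_fm \<sigma> F" and "\<And>c. c \<in> csts \<sigma> \<Longrightarrow> \<kappa> (f c) = Cst c"
  shows "translate (has_arity \<sigma>) \<kappa> (map_fm id f F) = F"
  using assms(1)
proof (induction F)
  case (Atom P ts)
  have "translate_tm \<kappa> (map_tm f t) = t" if "t \<in> set ts" for t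
    using Atom that assms(2) by (cases t) (auto simp: Tm_def)
  then show ?case using Atom by (simp add: has_arity_def map_idI)
qed auto

lemma translate_in_Form:
  assumes "range \<kappa> \<subseteq> Tm \<sigma>"
  shows "translate (has_arity \<sigma>) \<kappa> F \<in> Form \<sigma>"
proof -
  have "translate_tm \<kappa> t \<in> Tm \<sigma>" for t using assms by (cases t) (auto simp: Tm_def)
  then show ?thesis unfolding Form_def by (induction F) (auto simp: has_arity_def)
qed

lemma QBK_if_provable_map_fm:
  assumes "provable UNIV (map_fm id f F)" and "inj f" and F: "F \<in> Form \<sigma>"
  shows "F \<in> QBK \<sigma>"
proof -
  obtain N where N: "\<And>\<kappa>. variables_from N \<kappa> \<Longrightarrow> range (translate (has_arity \<sigma>) \<kappa>) \<subseteq> Form \<sigma> \<Longrightarrow>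
      provable (Form \<sigma>) (translate (has_arity \<sigma>) \<kappa> (map_fm id f F))"
    using eventually_happens'[OF sequentially_bot provable_translate[OF assms(1)]] by blast
  define \<kappa> where "\<kappa> = (\<lambda>d. if d \<in> f ` csts \<sigma> then Cst (inv f d) else Var N)"
  have "range \<kappa> \<subseteq> Tm \<sigma>" by (auto simp: \<kappa>_def Tm_def inv_f_f[OF \<open>inj f\<close>])
  then have "provable (Form \<sigma>) (translate (has_arity \<sigma>) \<kappa> (map_fm id f F))"
    using translate_in_Form[of \<kappa> \<sigma>] by (intro N) (auto simp: \<kappa>_def variables_from_def)
  moreover have "translate (has_arity \<sigma>) \<kappa> (map_fm id f F) = F"
    using F by (intro translate_map_fm) (auto simp: \<kappa>_def Form_def inv_f_f[OF \<open>inj f\<close>])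
  ultimately show ?thesis by (simp add: QBK_iff_provable)
qed

lemma provable_generalization:
  assumes "provable UNIV F"
  shows "provable UNIV (Forall x F)"
proof -
  have "provable UNIV (Imp F (Imp (Imp Bot Bot) F))" by (intro provable_axiom axiom.intros)
  with assms have "provable UNIV (Imp (Imp Bot Bot) F)" by (rule provable.MP)
  then have "provable UNIV (Imp (Imp Bot Bot) (Forall x F))" by (rule provable.BR1) simp
  moreover have "provable UNIV (Imp Bot Bot)" by (intro provable_axiom axiom.intros)
  ultimately show ?thesis by (rule provable.MP[rotated])
qed

lemma provable_if_provable_subst1_Cst:
  fixes F :: "('p, 'c) fm"
  assumes "provable UNIV (subst1 x (Cst c) F)" and fresh: "c \<notin> set2_fm F"
  shows "provable UNIV F"
proof -
  have "\<forall>\<^sub>F y in sequentially. (\<forall>z\<in>insert x (all_vars F). z < y) \<and>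
      (\<forall>\<kappa> :: 'c \<Rightarrow> 'c tm. variables_from y \<kappa> \<longrightarrow>
        provable UNIV (translate (\<lambda>_ _. True) \<kappa> (subst1 x (Cst c) F)))"
    using provable_translate[OF assms(1), of "\<lambda>_ _. True" UNIV]
    by (intro eventually_conj eventually_greater) auto
  from eventually_happens'[OF sequentially_bot this] obtain y where
    y: "y \<notin> all_vars F" "x < y" and
    translated: "\<And>\<kappa> :: 'c \<Rightarrow> 'c tm. variables_from y \<kappa> \<Longrightarrow>
      provable UNIV (translate (\<lambda>_ _. True) \<kappa> (subst1 x (Cst c) F))"
    by auto
  let ?\<kappa> = "Cst(c := Var y)"
  have "provable UNIV (translate (\<lambda>_ _. True) ?\<kappa> (subst1 x (Cst c) F))"
    by (rule translated) (auto simp: variables_from_def)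
  moreover have "translate (\<lambda>_ _. True) ?\<kappa> F = F"
    by (rule translate_id) (use fresh in auto)
  then have "translate (\<lambda>_ _. True) ?\<kappa> (subst1 x (Cst c) F) = subst1 x (Var y) F"
    using y(2) fresh by (subst translate_subst1) auto
  ultimately have "provable UNIV (Forall y (subst1 x (Var y) F))"
    by (simp add: provable_generalization)
  moreover have "provable UNIV (Imp (Forall y (subst1 x (Var y) F))
      (subst1 y (Var x) (subst1 x (Var y) F)))"
    by (intro provable_axiom axiom.intros free_for_fresh_inverse y)
  ultimately show ?thesis
    unfolding subst1_fresh_inverse[OF y(1)] by (rule provable.MP)
qed

lemma provable_if_provable_subst_Cst:
  fixes F :: "('p, 'c) fm"
  assumes "provable UNIV (subst (\<lambda>x. Cst (k x)) F)" and "inj k" and "range k \<inter> set2_fm F = {}"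
  shows "provable UNIV F"
proof -
  define s where "s X x = (if x \<in> X then Cst (k x) else Var x)" for X x
  have "provable UNIV F" if "finite X" "provable UNIV (subst (s X) F)" for X
    using that
  proof (induction X)
    case empty
    then show ?case by (simp add: s_def)
  next
    case (insert x X)
    have "subst1 x (Cst (k x)) (subst (s X) F) = subst (s (insert x X)) F"
      unfolding subst1_def
      by (subst subst_subst) (auto intro!: subst_cong simp: s_def insert.hyps)
    then have "provable UNIV (subst1 x (Cst (k x)) (subst (s X) F))" using insert.prems by simp
    moreover have "k x \<notin> set_tm (s X y)" for y
      using insert.hyps(2) assms(2) by (auto simp: s_def dest: injD)
    then have "k x \<notin> set2_fm (subst (s X) F)" using set2_fm_subst[of "s X" F] assms(3) by blast
    ultimately have "provable UNIV (subst (s X) F)" by (rule provable_if_provable_subst1_Cst)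
    then show ?case by (rule insert.IH)
  qed
  moreover have "subst (s (fv F)) F = subst (\<lambda>x. Cst (k x)) F"
    by (rule subst_cong) (simp add: s_def)
  ultimately show ?thesis using finite_fv[of F] assms(1) by metis
qed

section \<open>Maximal consistent sets\<close>

inductive derivable :: "('p, 'c) fm set \<Rightarrow> ('p, 'c) fm \<Rightarrow> bool" (infix "\<turnstile>" 50) for T where
  hyp: "F \<in> T \<Longrightarrow> T \<turnstile> F"
| provable: "provable UNIV F \<Longrightarrow> T \<turnstile> F"
| mp: "T \<turnstile> F \<Longrightarrow> T \<turnstile> Imp F G \<Longrightarrow> T \<turnstile> G"

abbreviation consistent :: "('p, 'c) fm set \<Rightarrow> bool" where
  "consistent T \<equiv> \<not> T \<turnstile> Bot"

lemma derivable_axiom: "axiom F \<Longrightarrow> T \<turnstile> F"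
  by (intro derivable.provable provable_axiom)

lemma derivable_mono: "T \<turnstile> F \<Longrightarrow> T \<subseteq> T' \<Longrightarrow> T' \<turnstile> F"
  by (induction rule: derivable.induct) (auto intro: derivable.intros)

lemma derivable_empty_iff: "{} \<turnstile> F \<longleftrightarrow> provable UNIV F"
proof
  show "{} \<turnstile> F \<Longrightarrow> provable UNIV F"
    by (induction rule: derivable.induct) (auto intro: provable.MP)
qed (rule derivable.provable)

lemma derivable_trans: "S \<turnstile> F \<Longrightarrow> (\<And>G. G \<in> S \<Longrightarrow> T \<turnstile> G) \<Longrightarrow> T \<turnstile> F"
  by (induction rule: derivable.induct) (auto intro: derivable.intros)

lemma derivable_finite: "T \<turnstile> F \<Longrightarrow> \<exists>S\<subseteq>T. finite S \<and> S \<turnstile> F"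
proof (induction rule: derivable.induct)
  case (hyp F)
  then show ?case by (intro exI[of _ "{F}"]) (auto intro: derivable.hyp)
next
  case (provable F)
  then show ?case by (intro exI[of _ "{}"]) (auto intro: derivable.provable)
next
  case (mp F G)
  then obtain S S' where "S \<subseteq> T" "finite S" "S \<turnstile> F" "S' \<subseteq> T" "finite S'" "S' \<turnstile> Imp F G"
    by blast
  then show ?case
    by (intro exI[of _ "S \<union> S'"]) (auto intro: derivable.mp[of _ F] derivable_mono)
qed

lemma derivable_Un_imageE:
  assumes "T \<union> f ` P \<turnstile> F"
  obtains U where "U \<subseteq> P" and "finite U" and "T \<union> f ` U \<turnstile> F"
proof -
  obtain S where S: "S \<subseteq> T \<union> f ` P" "finite S" "S \<turnstile> F" using derivable_finite[OF assms] by blast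
  then have "finite (S - T)" and "S - T \<subseteq> f ` P" by auto
  then obtain U where U: "U \<subseteq> P" "finite U" "S - T = f ` U" using finite_subset_image by metis
  moreover have "T \<union> f ` U \<turnstile> F" using S(3) by (rule derivable_mono) (use U(3) in blast)
  ultimately show ?thesis using that by blast
qed

lemma derivable_Imp_refl: "T \<turnstile> Imp F F"
proof -
  have "T \<turnstile> Imp F (Imp (Imp F F) F)"
    and "T \<turnstile> Imp (Imp F (Imp (Imp F F) F)) (Imp (Imp F (Imp F F)) (Imp F F))"
    and "T \<turnstile> Imp F (Imp F F)"
    by (intro derivable_axiom axiom.intros)+
  then show ?thesis using derivable.mp by blast
qed

lemma derivable_weaken: "T \<turnstile> F \<Longrightarrow> T \<turnstile> Imp G F"
  by (erule derivable.mp) (intro derivable_axiom axiom.intros)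

lemma derivable_Imp_iff: "T \<turnstile> Imp F G \<longleftrightarrow> insert F T \<turnstile> G"
proof
  assume "T \<turnstile> Imp F G"
  then have "insert F T \<turnstile> Imp F G" by (rule derivable_mono) blast
  then show "insert F T \<turnstile> G" by (rule derivable.mp[rotated]) (simp add: derivable.hyp)
next
  show "insert F T \<turnstile> G \<Longrightarrow> T \<turnstile> Imp F G"
  proof (induction rule: derivable.induct)
    case (hyp G)
    then show ?case by (auto intro: derivable_Imp_refl derivable_weaken derivable.hyp)
  next
    case (provable G)
    then show ?case by (intro derivable_weaken derivable.provable)
  next
    case (mp G H)
    have "T \<turnstile> Imp (Imp F (Imp G H)) (Imp (Imp F G) (Imp F H))"
      by (intro derivable_axiom axiom.intros)
    then show ?case using mp.IH derivable.mp by blast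
  qed
qed

lemma derivable_foldr_Imp_iff: "T \<turnstile> foldr Imp Fs F \<longleftrightarrow> set Fs \<union> T \<turnstile> F"
  by (induction Fs arbitrary: T) (simp_all add: derivable_Imp_iff)

lemma derivable_iff_provable: "T \<turnstile> F \<longleftrightarrow> (\<exists>Fs. set Fs \<subseteq> T \<and> provable UNIV (foldr Imp Fs F))"
proof
  assume "T \<turnstile> F"
  then obtain S where "S \<subseteq> T" "finite S" "S \<turnstile> F" using derivable_finite by blast
  moreover then obtain Fs where "set Fs = S" using finite_list by blast
  ultimately have "set Fs \<subseteq> T \<and> {} \<turnstile> foldr Imp Fs F" by (simp add: derivable_foldr_Imp_iff)
  then show "\<exists>Fs. set Fs \<subseteq> T \<and> provable UNIV (foldr Imp Fs F)" by (auto simp: derivable_empty_iff)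
next
  assume "\<exists>Fs. set Fs \<subseteq> T \<and> provable UNIV (foldr Imp Fs F)"
  then obtain Fs where "set Fs \<subseteq> T" "T \<turnstile> foldr Imp Fs F" using derivable.provable by blast
  then show "T \<turnstile> F" by (simp add: derivable_foldr_Imp_iff Un_absorb1)
qed

lemma derivable_cut: "T \<turnstile> F \<Longrightarrow> insert F T \<turnstile> G \<Longrightarrow> T \<turnstile> G"
  unfolding derivable_Imp_iff[symmetric] by (rule derivable.mp)

lemma derivable_ex_falso: "T \<turnstile> Bot \<Longrightarrow> T \<turnstile> F"
  by (erule derivable.mp) (intro derivable_axiom axiom.intros)

lemma derivable_contradiction: "T \<turnstile> F \<Longrightarrow> T \<turnstile> Neg F \<Longrightarrow> T \<turnstile> G"
  by (blast intro: derivable.mp derivable_ex_falso)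

lemma derivable_cases:
  assumes "insert F T \<turnstile> G" and "insert (Neg F) T \<turnstile> G"
  shows "T \<turnstile> G"
proof -
  have "T \<turnstile> Imp (Imp F G) (Imp (Imp (Neg F) G) (Imp (Or F (Neg F)) G))" and "T \<turnstile> Or F (Neg F)"
    by (intro derivable_axiom axiom.intros)+
  moreover have "T \<turnstile> Imp F G" and "T \<turnstile> Imp (Neg F) G" using assms by (simp_all add: derivable_Imp_iff)
  ultimately show ?thesis using derivable.mp by blast
qed

lemma derivable_ccontr: "insert (Neg F) T \<turnstile> Bot \<Longrightarrow> T \<turnstile> F"
  by (rule derivable_cases[of F]) (auto intro: derivable.hyp derivable_ex_falso)

lemma derivable_disjunctionI: "F \<in> set Fs \<Longrightarrow> T \<turnstile> F \<Longrightarrow> T \<turnstile> disjunction Fs"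
proof (induction Fs rule: disjunction.induct)
  case (3 G H Fs)
  have "T \<turnstile> Imp G (Or G (disjunction (H # Fs)))"
    and "T \<turnstile> Imp (disjunction (H # Fs)) (Or G (disjunction (H # Fs)))"
    by (intro derivable_axiom axiom.intros)+
  then show ?case using 3 derivable.mp by (metis disjunction.simps(3) set_ConsD)
qed auto

lemma derivable_disjunction_if_inconsistent:
  assumes "T \<union> Neg ` set Fs \<turnstile> Bot"
  shows "T \<turnstile> disjunction Fs"
proof (rule derivable_ccontr, rule derivable_trans[OF assms])
  let ?T = "insert (Neg (disjunction Fs)) T"
  have "?T \<turnstile> Neg F" if "F \<in> set Fs" for F
    unfolding derivable_Imp_iff
  proof (rule derivable_contradiction)
    show "insert F ?T \<turnstile> disjunction Fs" using that derivable_disjunctionI derivable.hyp by blast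
    show "insert F ?T \<turnstile> Neg (disjunction Fs)" by (simp add: derivable.hyp)
  qed
  then show "?T \<turnstile> G" if "G \<in> T \<union> Neg ` set Fs" for G using that by (auto intro: derivable.hyp)
qed

lemma provable_Box:
  assumes "provable UNIV F"
  shows "provable UNIV (Box F)"
proof -
  have "{} \<turnstile> Imp (Imp F F) F" using assms by (intro derivable_weaken derivable.provable)
  then have "provable UNIV (Imp (Box (Imp F F)) (Box F))"
    unfolding derivable_empty_iff by (rule provable.MB)
  moreover have "provable UNIV (Box (Imp F F))" by (intro provable_axiom axiom.intros)
  ultimately show ?thesis by (rule provable.MP[rotated])
qed

lemma derivable_Box_mp:
  assumes "T \<turnstile> Box F" and "T \<turnstile> Box (Imp F G)"
  shows "T \<turnstile> Box G"
proof -
  let ?C = "And F (Imp F G)"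
  have "{?C} \<turnstile> Imp ?C F" and "{?C} \<turnstile> Imp ?C (Imp F G)"
    by (intro derivable_axiom axiom.intros)+
  moreover have "{?C} \<turnstile> ?C" by (simp add: derivable.hyp)
  ultimately have "{?C} \<turnstile> G" using derivable.mp by blast
  then have "provable UNIV (Imp ?C G)" by (simp add: derivable_Imp_iff flip: derivable_empty_iff)
  then have "T \<turnstile> Imp (Box ?C) (Box G)" by (intro derivable.provable provable.MB)
  moreover have "T \<turnstile> Imp (Box F) (Imp (Box (Imp F G)) (And (Box F) (Box (Imp F G))))"
    and "T \<turnstile> Imp (And (Box F) (Box (Imp F G))) (Box ?C)"
    by (intro derivable_axiom axiom.intros)+
  ultimately show ?thesis using assms by (metis derivable.mp)
qed

lemma derivable_Box: "T \<turnstile> F \<Longrightarrow> Box ` T \<turnstile> Box F"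
proof (induction rule: derivable.induct)
  case (hyp F)
  then show ?case by (simp add: derivable.hyp)
next
  case (provable F)
  then show ?case by (intro derivable.provable provable_Box)
next
  case (mp F G)
  show ?case using mp.IH by (rule derivable_Box_mp)
qed

lemma derivable_Exists_elim:
  assumes "insert (subst1 x (Cst c) F) T \<turnstile> G" and "c \<notin> set2_fm F" and "c \<notin> set2_fm G" and "x \<notin> fv G"
    and T: "\<And>H. H \<in> T \<Longrightarrow> c \<notin> set2_fm H \<and> x \<notin> fv H"
  shows "insert (Exists x F) T \<turnstile> G"
proof -
  let ?F = "subst1 x (Cst c) F"
  have "T \<turnstile> Imp ?F G" using assms(1) by (simp add: derivable_Imp_iff)
  then obtain Hs where Hs: "set Hs \<subseteq> T" "{} \<turnstile> foldr Imp Hs (Imp ?F G)"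
    unfolding derivable_iff_provable[of T] derivable_empty_iff by blast
  let ?G = "foldr Imp Hs G"
  have G: "x \<notin> fv ?G" "c \<notin> set2_fm ?G" using T Hs(1) assms(3,4) by (auto simp: foldr_Imp_simps)
  have "{} \<turnstile> Imp ?F ?G"
    using Hs(2) by (simp add: derivable_foldr_Imp_iff derivable_Imp_iff insert_commute)
  then have "provable UNIV (subst1 x (Cst c) (Imp F ?G))"
    using G by (simp add: subst1_not_free derivable_empty_iff)
  then have "provable UNIV (Imp F ?G)"
    by (rule provable_if_provable_subst1_Cst) (use assms(2) G in auto)
  then have "provable UNIV (Imp (Exists x F) ?G)" using G(1) by (rule provable.BR2)
  then have "insert (Exists x F) {} \<turnstile> ?G"
    unfolding derivable_Imp_iff[symmetric] by (rule derivable.provable)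
  then show ?thesis
    unfolding derivable_foldr_Imp_iff by (rule derivable_mono) (use Hs(1) in auto)
qed

definition maximal_consistent :: "('p, 'c) fm set \<Rightarrow> bool" where
  "maximal_consistent w \<longleftrightarrow> consistent w \<and> (\<forall>F. F \<in> w \<or> Neg F \<in> w)"

lemma consistent_Union_chain:
  assumes "C \<noteq> {}" and "subset.chain {w. consistent w} C"
  shows "consistent (\<Union>C)"
proof
  assume "\<Union>C \<turnstile> Bot"
  then obtain S where S: "S \<subseteq> \<Union>C" "finite S" "S \<turnstile> Bot" using derivable_finite by blast
  obtain w where w: "w \<in> C" "S \<subseteq> w" using finite_subset_Union_chain[OF S(2,1) assms] by blast
  then have "w \<turnstile> Bot" using S(3) derivable_mono by blast
  then show False using w(1) assms(2) by (auto simp: subset.chain_def)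
qed

lemma maximal_consistent_extension:
  assumes "consistent T"
  obtains w where "T \<subseteq> w" and "maximal_consistent w"
proof -
  let ?A = "{w. T \<subseteq> w \<and> consistent w}"
  have "\<exists>w\<in>?A. \<forall>X\<in>?A. w \<subseteq> X \<longrightarrow> X = w"
  proof (rule subset_Zorn_nonempty)
    show "?A \<noteq> {}" using assms by blast
  next
    fix C assume C: "C \<noteq> {}" "subset.chain ?A C"
    then have "subset.chain {w. consistent w} C" by (auto simp: subset.chain_def)
    then have "consistent (\<Union>C)" by (rule consistent_Union_chain[OF C(1)])
    then show "\<Union>C \<in> ?A" using C by (fastforce simp: subset.chain_def)
  qed
  then obtain w where w: "T \<subseteq> w" "consistent w" and max: "\<And>X. T \<subseteq> X \<Longrightarrow> consistent X \<Longrightarrow> w \<subseteq> X \<Longrightarrow> X = w"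
    by auto
  have "F \<in> w \<or> Neg F \<in> w" for F
    using max[of "insert F w"] max[of "insert (Neg F) w"] derivable_cases[of F w Bot] w by blast
  then show ?thesis using that w by (simp add: maximal_consistent_def)
qed

definition signed :: "bool \<Rightarrow> ('p, 'c) fm \<Rightarrow> ('p, 'c) fm" where
  "signed b F = (if b then F else SNeg F)"

lemma signed_simps [simp]: "signed True F = F" "signed False F = SNeg F"
  by (simp_all add: signed_def)

context
  fixes w :: "('p, 'c) fm set"
  assumes mcs: "maximal_consistent w"
begin

lemma mcs_derivable: "w \<turnstile> F \<Longrightarrow> F \<in> w"
  using mcs derivable_contradiction[of w F Bot]
  by (auto simp: maximal_consistent_def intro: derivable.hyp)

lemma mcs_provable: "provable UNIV F \<Longrightarrow> F \<in> w"
  by (intro mcs_derivable derivable.provable)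

lemma mcs_axiom: "axiom F \<Longrightarrow> F \<in> w"
  by (intro mcs_provable provable_axiom)

lemma mcs_mp: "Imp F G \<in> w \<Longrightarrow> F \<in> w \<Longrightarrow> G \<in> w"
  using mcs_derivable derivable.mp derivable.hyp by blast

lemma mcs_Bot: "Bot \<notin> w"
  using mcs derivable.hyp by (auto simp: maximal_consistent_def)

lemma mcs_Imp: "Imp F G \<in> w \<longleftrightarrow> (F \<in> w \<longrightarrow> G \<in> w)"
proof
  assume "F \<in> w \<longrightarrow> G \<in> w"
  then consider "G \<in> w" | "Neg F \<in> w" using mcs by (auto simp: maximal_consistent_def)
  then show "Imp F G \<in> w"
  proof cases
    assume "G \<in> w"
    then show ?thesis by (rule mcs_derivable[OF derivable_weaken[OF derivable.hyp]])
  next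
    assume "Neg F \<in> w"
    then have "insert F w \<turnstile> G"
      by (intro derivable_contradiction[of _ F, OF derivable.hyp derivable.hyp]) simp_all
    then show ?thesis by (rule mcs_derivable[OF derivable_Imp_iff[THEN iffD2]])
  qed
qed (use mcs_mp in blast)

lemma mcs_And: "And F G \<in> w \<longleftrightarrow> F \<in> w \<and> G \<in> w"
proof -
  have "Imp (And F G) F \<in> w" "Imp (And F G) G \<in> w" "Imp F (Imp G (And F G)) \<in> w"
    by (intro mcs_axiom axiom.intros)+
  then show ?thesis by (auto simp: mcs_Imp)
qed

lemma mcs_Or: "Or F G \<in> w \<longleftrightarrow> F \<in> w \<or> G \<in> w"
proof -
  have "Imp F (Or F G) \<in> w" "Imp G (Or F G) \<in> w" "Imp (Neg F) (Imp (Neg G) (Neg (Or F G))) \<in> w"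
    by (intro mcs_axiom axiom.intros)+
  then show ?thesis by (auto simp: mcs_Imp mcs_Bot)
qed

lemma mcs_Iff_axiom: "axiom (Iff F G) \<Longrightarrow> F \<in> w \<longleftrightarrow> G \<in> w"
  using mcs_axiom[of "Iff F G"] by (auto simp: mcs_And mcs_Imp)

lemma mcs_SNeg:
  "SNeg (SNeg F) \<in> w \<longleftrightarrow> F \<in> w"
  "SNeg (Imp F G) \<in> w \<longleftrightarrow> F \<in> w \<and> SNeg G \<in> w"
  "SNeg (Or F G) \<in> w \<longleftrightarrow> SNeg F \<in> w \<and> SNeg G \<in> w"
  "SNeg (And F G) \<in> w \<longleftrightarrow> SNeg F \<in> w \<or> SNeg G \<in> w"
  "SNeg (Forall x F) \<in> w \<longleftrightarrow> Exists x (SNeg F) \<in> w"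
  "SNeg (Exists x F) \<in> w \<longleftrightarrow> Forall x (SNeg F) \<in> w"
  unfolding mcs_And[symmetric] mcs_Or[symmetric] by (intro mcs_Iff_axiom axiom.intros)+

lemma mcs_SNeg_Bot: "SNeg Bot \<in> w"
  by (intro mcs_axiom axiom.intros)

lemma mcs_Dia_iff_Box: "Dia F \<in> w \<longleftrightarrow> Box (Neg F) \<notin> w"
proof -
  have "Neg (Dia F) \<in> w \<longleftrightarrow> Box (Neg F) \<in> w" by (intro mcs_Iff_axiom axiom.intros)
  then show ?thesis by (auto simp: mcs_Imp mcs_Bot)
qed

lemma mcs_SNeg_modal:
  "SNeg (Box F) \<in> w \<longleftrightarrow> Dia (SNeg F) \<in> w"
  "SNeg (Dia F) \<in> w \<longleftrightarrow> Box (SNeg F) \<in> w"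
proof -
  have "SIff (Box F) (SNeg (Dia (SNeg F))) \<in> w" and "SIff (Dia F) (SNeg (Box (SNeg F))) \<in> w"
    by (intro mcs_axiom axiom.intros)+
  then show "SNeg (Box F) \<in> w \<longleftrightarrow> Dia (SNeg F) \<in> w" and "SNeg (Dia F) \<in> w \<longleftrightarrow> Box (SNeg F) \<in> w"
    unfolding mcs_And mcs_Imp mcs_SNeg(1) by argo+
qed

lemma mcs_signed:
  "signed b Bot \<in> w \<longleftrightarrow> \<not> b"
  "signed b (Imp F G) \<in> w \<longleftrightarrow> (if b then F \<in> w \<longrightarrow> G \<in> w else F \<in> w \<and> SNeg G \<in> w)"
  "signed b (And F G) \<in> w \<longleftrightarrow> (if b then F \<in> w \<and> G \<in> w else SNeg F \<in> w \<or> SNeg G \<in> w)"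
  "signed b (Or F G) \<in> w \<longleftrightarrow> (if b then F \<in> w \<or> G \<in> w else SNeg F \<in> w \<and> SNeg G \<in> w)"
  "signed b (SNeg F) \<in> w \<longleftrightarrow> signed (\<not> b) F \<in> w"
  by (cases b; simp add: mcs_Bot mcs_Imp mcs_And mcs_Or mcs_SNeg mcs_SNeg_Bot)+

lemma mcs_Forall_subst1: "Forall x F \<in> w \<Longrightarrow> subst1 x (Cst c) F \<in> w"
  by (rule mcs_mp[OF mcs_axiom]) (simp_all add: axiom.intros free_for_closed)

lemma mcs_subst1_Exists: "subst1 x (Cst c) F \<in> w \<Longrightarrow> Exists x F \<in> w"
  by (rule mcs_mp[OF mcs_axiom]) (simp_all add: axiom.intros free_for_closed)

lemma mcs_not_Forall:
  assumes "Forall x F \<notin> w"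
  shows "Exists x (Neg F) \<in> w"
proof -
  let ?E = "Exists x (Neg F)"
  let ?T = "{Neg F, Neg ?E}"
  have "axiom (Imp (subst1 x (Var x) (Neg F)) ?E)" by (intro axiom.intros free_for_Var_same)
  then have "?T \<turnstile> Imp (Neg F) ?E" by (simp add: derivable_axiom)
  then have "?T \<turnstile> ?E" by (rule derivable.mp[rotated]) (simp add: derivable.hyp)
  then have "?T \<turnstile> Bot" by (rule derivable_contradiction) (simp add: derivable.hyp)
  then have "{Neg ?E} \<turnstile> F" by (rule derivable_ccontr)
  then have "provable UNIV (Imp (Neg ?E) F)" by (simp add: derivable_Imp_iff flip: derivable_empty_iff)
  then have "provable UNIV (Imp (Neg ?E) (Forall x F))" by (rule provable.BR1) simp
  then have "Imp (Neg ?E) (Forall x F) \<in> w" by (rule mcs_provable)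
  then show ?thesis using assms by (auto simp: mcs_Imp mcs_Bot)
qed

end

section \<open>Henkin constants\<close>

primrec encode_tm :: "('p, 'c) fm tm \<Rightarrow> ('p, 'c) fm" where
  "encode_tm (Var x) = Forall x Bot"
| "encode_tm (Cst F) = SNeg F"

text \<open>The extra \<open>Bot\<close> separates the images of conjunctions and atoms.\<close>

primrec encode :: "('p, ('p, 'c) fm) fm \<Rightarrow> ('p, 'c) fm" where
  "encode (Atom P ts) = And (Atom P []) (foldr And (map encode_tm ts) Bot)"
| "encode Bot = Bot"
| "encode (Imp F G) = Imp (encode F) (encode G)"
| "encode (And F G) = And Bot (And (encode F) (encode G))"
| "encode (Or F G) = Or (encode F) (encode G)"
| "encode (SNeg F) = SNeg (encode F)"
| "encode (Box F) = Box (encode F)"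
| "encode (Dia F) = Dia (encode F)"
| "encode (Forall x F) = Forall x (encode F)"
| "encode (Exists x F) = Exists x (encode F)"

lemma inj_encode_tm: "inj encode_tm"
proof (rule injI)
  show "t = t'" if "encode_tm t = encode_tm t'" for t t' :: "('p, 'c) fm tm"
    using that by (cases t; cases t') auto
qed

lemma foldr_And_eqD: "foldr And Fs Bot = foldr And Gs Bot \<Longrightarrow> Fs = Gs"
proof (induction Fs arbitrary: Gs)
  case Nil
  then show ?case by (cases Gs) auto
next
  case (Cons F Fs)
  then show ?case by (cases Gs) auto
qed

lemma encode_eqD: "encode F = encode G \<Longrightarrow> F = G"
proof (induction F arbitrary: G rule: fm_induct)
  case (Atom P ts)
  then show ?case
    by (cases G) (auto dest!: foldr_And_eqD simp: inj_map_eq_map[OF inj_encode_tm])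
next
  case Bot
  then show ?case by (cases G) auto
next
  case (Binary C F1 F2)
  from Binary.hyps Binary.prems show ?case by (cases G) (auto dest: Binary.IH)
next
  case (SNeg F)
  from SNeg.prems show ?case by (cases G) (auto dest: SNeg.IH)
next
  case (Modal M F)
  from Modal.hyps Modal.prems show ?case by (cases G) (auto dest: Modal.IH)
next
  case (Quantifier Q x F)
  from Quantifier.hyps Quantifier.prems show ?case by (cases G) (auto dest: Quantifier.IH)
qed

lemma size_less_foldr_And: "F \<in> set Fs \<Longrightarrow> size F < size (foldr And Fs Bot)"
  by (induction Fs) auto

lemma size_less_encode: "c \<in> set2_fm F \<Longrightarrow> size c < size (encode F)"
proof (induction F)
  case (Atom P ts)
  then obtain t where t: "t \<in> set ts" "c \<in> set_tm t" by auto
  from t(2) have "size c < size (encode_tm t)" by (cases t) auto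
  also have "\<dots> < size (foldr And (map encode_tm ts) Bot)" using t(1) by (simp add: size_less_foldr_And)
  finally show ?case by simp
qed auto

type_synonym ('p, 'c) henkin_fm = "('p, ('p, 'c) fm) fm"

text \<open>The formulas of the given language are themselves the constants of the language in which
  worlds are built. \<open>Old c\<close> stands for the given constant \<open>c\<close>, \<open>Par x\<close> for the free variable \<open>x\<close> of
  the succedent, and \<open>Wit n x F\<close> is the witness of \<open>Exists x F\<close> introduced at level \<open>n\<close>. As \<open>F\<close> may
  contain witnesses of level \<open>n\<close> again, one round of witnesses per level suffices.\<close>

definition Old :: "'c \<Rightarrow> ('p, 'c) fm" where
  "Old c = Atom undefined [Cst c]"

definition Par :: "nat \<Rightarrow> ('p, 'c) fm" where
  "Par x = Forall x Bot"

definition Wit :: "nat \<Rightarrow> nat \<Rightarrow> ('p, 'c) henkin_fm \<Rightarrow> ('p, 'c) fm" where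
  "Wit n x F = Exists n (Exists x (encode F))"

definition level :: "('p, 'c) fm \<Rightarrow> nat" where
  "level c = (case c of Exists n F \<Rightarrow> Suc n | _ \<Rightarrow> 0)"

lemma level_simps [simp]: "level (Old c) = 0" "level (Par x) = 0" "level (Wit n x F) = Suc n"
  by (simp_all add: level_def Old_def Par_def Wit_def)

lemma inj_Old: "inj Old" and inj_Par: "inj Par" and Par_neq_Old: "Par x \<noteq> Old c"
  by (simp_all add: inj_def Old_def Par_def)

lemma Wit_inject: "Wit n x F = Wit n y G \<longleftrightarrow> x = y \<and> F = G"
  by (auto simp: Wit_def dest: encode_eqD)

lemma size_less_Wit: "c \<in> set2_fm F \<Longrightarrow> size c < size (Wit n x F)"
  using size_less_encode[of c F] by (simp add: Wit_def)

definition bounded_sentence :: "nat \<Rightarrow> ('p, 'c) henkin_fm \<Rightarrow> bool" where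
  "bounded_sentence n F \<longleftrightarrow> fv F = {} \<and> (\<forall>c\<in>set2_fm F. level c \<le> n)"

lemma bounded_sentence_simps [simp]:
  "bounded_sentence n (Neg F) \<longleftrightarrow> bounded_sentence n F"
  "bounded_sentence n (SNeg F) \<longleftrightarrow> bounded_sentence n F"
  by (simp_all add: bounded_sentence_def)

definition henkin_axiom :: "nat \<Rightarrow> nat \<times> ('p, 'c) henkin_fm \<Rightarrow> ('p, 'c) henkin_fm" where
  "henkin_axiom n = (\<lambda>(x, F). Imp (Exists x F) (subst1 x (Cst (Wit n x F)) F))"

lemma fv_henkin_axiom: "fv F \<subseteq> {x} \<Longrightarrow> fv (henkin_axiom n (x, F)) = {}"
  using fv_subst1_closed[of "Cst (Wit n x F)" x F] by (auto simp: henkin_axiom_def)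

lemma set2_fm_henkin_axiom: "set2_fm (henkin_axiom n (x, F)) \<subseteq> insert (Wit n x F) (set2_fm F)"
  using set2_fm_subst[of "Var(x := Cst (Wit n x F))" F]
  by (fastforce simp: henkin_axiom_def subst1_def split: if_splits)

lemma consistent_insert_henkin_axiom:
  assumes "consistent T" and T: "\<And>G. G \<in> T \<Longrightarrow> Wit n x F \<notin> set2_fm G \<and> x \<notin> fv G"
  shows "consistent (insert (henkin_axiom n (x, F)) T)"
proof
  let ?H = "henkin_axiom n (x, F)" and ?F = "subst1 x (Cst (Wit n x F)) F"
  assume H: "insert ?H T \<turnstile> Bot"
  have cut: "insert G T \<turnstile> Bot" if "insert G T \<turnstile> ?H" for G
    using that by (rule derivable_cut) (auto intro: derivable_mono[OF H])
  have "insert ?F T \<turnstile> Bot"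
    by (rule cut) (simp add: henkin_axiom_def derivable_weaken derivable.hyp)
  then have "insert (Exists x F) T \<turnstile> Bot"
    by (rule derivable_Exists_elim) (use T size_less_Wit[of "Wit n x F" F n x] in auto)
  moreover have "insert (Exists x F) (insert (Neg (Exists x F)) T) \<turnstile> ?F"
    by (rule derivable_contradiction[of _ "Exists x F"]) (simp_all add: derivable.hyp)
  then have "insert (Neg (Exists x F)) T \<turnstile> Bot"
    by (intro cut) (simp add: henkin_axiom_def derivable_Imp_iff)
  ultimately have "T \<turnstile> Bot" by (rule derivable_cases)
  with assms(1) show False ..
qed

lemma Wit_fresh_for_henkin_axiom:
  assumes "size (Wit n y G) \<le> size (Wit n x F)" and "(y, G) \<noteq> (x, F)"
  shows "Wit n x F \<notin> set2_fm (henkin_axiom n (y, G))"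
proof -
  have "Wit n x F \<notin> set2_fm G" using size_less_Wit[of "Wit n x F" G n y] assms(1) by auto
  moreover have "Wit n x F \<noteq> Wit n y G" using assms(2) by (auto simp: Wit_inject)
  ultimately show ?thesis using set2_fm_henkin_axiom[of n y G] by blast
qed

lemma consistent_Un_finite_henkin_axioms:
  assumes "consistent T" and T: "\<And>G. G \<in> T \<Longrightarrow> bounded_sentence n G"
    and "finite U" and "U \<subseteq> {(x, F). fv F \<subseteq> {x}}"
  shows "consistent (T \<union> henkin_axiom n ` U)"
  using assms(3,4)
proof (induction U rule: finite_ranking_induct[where f = "\<lambda>(x, F). size (Wit n x F)"])
  case empty
  then show ?case using assms(1) by simp
next
  case (insert p U)
  obtain x F where p: "p = (x, F)" by fastforce
  show ?case
  proof (cases "p \<in> U")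
    case True
    then show ?thesis using insert by (simp add: insert_absorb)
  next
    case False
    have "Wit n x F \<notin> set2_fm H \<and> x \<notin> fv H" if "H \<in> T \<union> henkin_axiom n ` U" for H
      using that
    proof
      assume "H \<in> T"
      then show ?thesis using T[of H] by (fastforce simp: bounded_sentence_def)
    next
      assume "H \<in> henkin_axiom n ` U"
      then obtain y G where "(y, G) \<in> U" "H = henkin_axiom n (y, G)" by auto
      then show ?thesis
        using False p insert.hyps(2)[of "(y, G)"] insert.prems fv_henkin_axiom[of G y n]
          Wit_fresh_for_henkin_axiom[of n y G x F] by auto
    qed
    then have "consistent (insert (henkin_axiom n (x, F)) (T \<union> henkin_axiom n ` U))"
      using insert by (intro consistent_insert_henkin_axiom) auto
    then show ?thesis by (simp add: p)
  qed
qed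

lemma consistent_Un_henkin_axioms:
  assumes "consistent T" and "\<And>G. G \<in> T \<Longrightarrow> bounded_sentence n G"
  shows "consistent (T \<union> henkin_axiom n ` {(x, F). fv F \<subseteq> {x}})"
  using derivable_Un_imageE consistent_Un_finite_henkin_axioms[OF assms] by metis

section \<open>Saturated sets\<close>

definition saturated :: "nat \<Rightarrow> ('p, 'c) henkin_fm set \<Rightarrow> bool" where
  "saturated n w \<longleftrightarrow> maximal_consistent w \<and>
     (\<forall>x F. fv F \<subseteq> {x} \<longrightarrow> Exists x F \<in> w \<longrightarrow> (\<exists>c. level c \<le> Suc n \<and> subst1 x (Cst c) F \<in> w))"

lemma saturated_maximal_consistent: "saturated n w \<Longrightarrow> maximal_consistent w"
  by (simp add: saturated_def)

lemma saturated_extension: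
  fixes T :: "('p, 'c) henkin_fm set"
  assumes "consistent T" and "\<And>G. G \<in> T \<Longrightarrow> bounded_sentence n G"
  obtains w where "T \<subseteq> w" and "saturated n w"
proof -
  obtain w where w: "T \<union> henkin_axiom n ` {(x, F). fv F \<subseteq> {x}} \<subseteq> w" "maximal_consistent w"
    using consistent_Un_henkin_axioms[OF assms] maximal_consistent_extension by blast
  have "level (Wit n x F) \<le> Suc n \<and> subst1 x (Cst (Wit n x F)) F \<in> w"
    if "fv F \<subseteq> {x}" "Exists x F \<in> w" for x and F :: "('p, 'c) henkin_fm"
  proof -
    have "henkin_axiom n (x, F) \<in> w" using w(1) that(1) by blast
    then show ?thesis using that(2) mcs_mp[OF w(2)] by (simp add: henkin_axiom_def)
  qed
  then have "saturated n w" unfolding saturated_def using w(2) by blast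
  then show ?thesis using that w(1) by blast
qed

lemma saturated_Exists:
  assumes "saturated n w" and "fv F \<subseteq> {x}"
  shows "Exists x F \<in> w \<longleftrightarrow> (\<exists>c. level c \<le> Suc n \<and> subst1 x (Cst c) F \<in> w)"
  using assms mcs_subst1_Exists[OF saturated_maximal_consistent[OF assms(1)]]
  by (auto simp: saturated_def)

lemma saturated_Forall:
  assumes "saturated n w" and "fv F \<subseteq> {x}"
  shows "Forall x F \<in> w \<longleftrightarrow> (\<forall>c. level c \<le> Suc n \<longrightarrow> subst1 x (Cst c) F \<in> w)"
proof
  note mcs = saturated_maximal_consistent[OF assms(1)]
  show "Forall x F \<in> w \<Longrightarrow> \<forall>c. level c \<le> Suc n \<longrightarrow> subst1 x (Cst c) F \<in> w"
    using mcs_Forall_subst1[OF mcs] by blast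
  assume inst: "\<forall>c. level c \<le> Suc n \<longrightarrow> subst1 x (Cst c) F \<in> w"
  have "subst1 x (Cst c) (Neg F) \<notin> w" if "level c \<le> Suc n" for c
    using inst that by (simp add: mcs_Imp[OF mcs] mcs_Bot[OF mcs])
  then have "Exists x (Neg F) \<notin> w" using saturated_Exists[OF assms(1), of "Neg F" x] assms(2) by auto
  then show "Forall x F \<in> w" using mcs_not_Forall[OF mcs] by blast
qed

lemma saturated_signed_quantifier:
  assumes "saturated n w" and "fv F \<subseteq> {x}"
  shows "signed b (Forall x F) \<in> w \<longleftrightarrow>
      (if b then \<forall>c. level c \<le> Suc n \<longrightarrow> subst1 x (Cst c) F \<in> w
       else \<exists>c. level c \<le> Suc n \<and> SNeg (subst1 x (Cst c) F) \<in> w)"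
    and "signed b (Exists x F) \<in> w \<longleftrightarrow>
      (if b then \<exists>c. level c \<le> Suc n \<and> subst1 x (Cst c) F \<in> w
       else \<forall>c. level c \<le> Suc n \<longrightarrow> SNeg (subst1 x (Cst c) F) \<in> w)"
  using saturated_Forall[OF assms(1), of F x] saturated_Forall[OF assms(1), of "SNeg F" x]
    saturated_Exists[OF assms(1), of F x] saturated_Exists[OF assms(1), of "SNeg F" x] assms(2)
    mcs_SNeg(5,6)[OF saturated_maximal_consistent[OF assms(1)]]
  by (cases b; simp)+

definition accessible :: "nat \<Rightarrow> ('p, 'c) henkin_fm set \<Rightarrow> ('p, 'c) henkin_fm set \<Rightarrow> bool" where
  "accessible n w u \<longleftrightarrow>
     saturated (Suc n) u \<and> (\<forall>F. bounded_sentence (Suc n) F \<longrightarrow> Box F \<in> w \<longrightarrow> F \<in> u)"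

lemma saturated_Box:
  assumes w: "maximal_consistent w" and F: "bounded_sentence (Suc n) F"
  shows "Box F \<in> w \<longleftrightarrow> (\<forall>u. accessible n w u \<longrightarrow> F \<in> u)"
proof
  show "Box F \<in> w \<Longrightarrow> \<forall>u. accessible n w u \<longrightarrow> F \<in> u" using F by (simp add: accessible_def)
  assume acc: "\<forall>u. accessible n w u \<longrightarrow> F \<in> u"
  let ?T = "{G. bounded_sentence (Suc n) G \<and> Box G \<in> w}"
  have "insert (Neg F) ?T \<turnstile> Bot"
  proof (rule ccontr)
    assume "consistent (insert (Neg F) ?T)"
    moreover have "bounded_sentence (Suc n) G" if "G \<in> insert (Neg F) ?T" for G
      using that F by auto
    ultimately obtain u where u: "insert (Neg F) ?T \<subseteq> u" "saturated (Suc n) u"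
      by (rule saturated_extension)
    then have "F \<in> u" and "Neg F \<in> u" using acc by (auto simp: accessible_def)
    then show False using saturated_maximal_consistent[OF u(2)] by (simp add: mcs_Imp mcs_Bot)
  qed
  then have "Box ` ?T \<turnstile> Box F" by (rule derivable_Box[OF derivable_ccontr])
  then have "w \<turnstile> Box F" by (rule derivable_mono) auto
  then show "Box F \<in> w" by (rule mcs_derivable[OF w])
qed

lemma saturated_Dia:
  assumes w: "maximal_consistent w" and F: "bounded_sentence (Suc n) F"
  shows "Dia F \<in> w \<longleftrightarrow> (\<exists>u. accessible n w u \<and> F \<in> u)"
proof -
  have "Neg F \<in> u \<longleftrightarrow> F \<notin> u" if "accessible n w u" for u
    using that saturated_maximal_consistent[of "Suc n" u] by (simp add: accessible_def mcs_Imp mcs_Bot)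
  then show ?thesis
    using saturated_Box[OF w, of n "Neg F"] F by (auto simp: mcs_Dia_iff_Box[OF w])
qed

lemma saturated_signed_modal:
  assumes w: "maximal_consistent w" and F: "bounded_sentence (Suc n) F"
  shows "signed b (Box F) \<in> w \<longleftrightarrow>
      (if b then \<forall>u. accessible n w u \<longrightarrow> F \<in> u else \<exists>u. accessible n w u \<and> SNeg F \<in> u)"
    and "signed b (Dia F) \<in> w \<longleftrightarrow>
      (if b then \<exists>u. accessible n w u \<and> F \<in> u else \<forall>u. accessible n w u \<longrightarrow> SNeg F \<in> u)"
  using saturated_Box[OF w, of n F] saturated_Box[OF w, of n "SNeg F"]
    saturated_Dia[OF w, of n F] saturated_Dia[OF w, of n "SNeg F"] F
    mcs_SNeg_modal[OF w]
  by (cases b; simp)+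

section \<open>The canonical model\<close>

definition encode_world :: "nat \<times> ('p, 'c) henkin_fm set \<Rightarrow> ('p, 'c) fm set" where
  "encode_world = (\<lambda>(n, w). insert (Forall n Bot) (SNeg ` encode ` w))"

lemma inj_encode_world: "inj encode_world"
proof (rule injI, clarify)
  fix n m and w u :: "('p, 'c) henkin_fm set"
  assume eq: "encode_world (n, w) = encode_world (m, u)"
  have "Forall k Bot \<in> encode_world (n, w) \<longleftrightarrow> k = n" for k n and w :: "('p, 'c) henkin_fm set"
    by (auto simp: encode_world_def)
  then have "n = m" using eq by metis
  have "SNeg (encode F) \<in> encode_world (n, w) \<longleftrightarrow> F \<in> w" for F n and w :: "('p, 'c) henkin_fm set"
    by (auto simp: encode_world_def dest: encode_eqD)
  then have "w = u" using eq by (metis subsetI subset_antisym)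
  with \<open>n = m\<close> show "n = m \<and> w = u" ..
qed

definition canonical_struct ::
  "('p, 'c) signature \<Rightarrow> bool \<Rightarrow> nat \<times> ('p, 'c) henkin_fm set \<Rightarrow> ('p, 'c, ('p, 'c) fm) struct"
where
  "canonical_struct \<sigma> b = (\<lambda>(n, w).
     \<lparr>carr = {c. level c \<le> Suc n},
      cint = Old,
      pint = (\<lambda>P. {cs. length cs = arity \<sigma> P \<and> (\<forall>c\<in>set cs. level c \<le> Suc n) \<and>
                       signed b (Atom P (map Cst cs)) \<in> w})\<rparr>)"

definition canonical_model ::
  "('p, 'c) signature \<Rightarrow> ('p, 'c, ('p, 'c) fm, ('p, 'c) fm set) model"
where
  "canonical_model \<sigma> =
     \<lparr>worlds = encode_world ` {(n, w). saturated n w},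
      acc = {(encode_world (n, w), encode_world (Suc n, u)) | n w u. saturated n w \<and> accessible n w u},
      pos = (\<lambda>v. canonical_struct \<sigma> True (inv encode_world v)),
      neg = (\<lambda>v. canonical_struct \<sigma> False (inv encode_world v))\<rparr>"

lemma canonical_struct_simps [simp]:
  "carr (canonical_struct \<sigma> b (n, w)) = {c. level c \<le> Suc n}"
  "cint (canonical_struct \<sigma> b (n, w)) = Old"
  "cs \<in> pint (canonical_struct \<sigma> b (n, w)) P \<longleftrightarrow>
     length cs = arity \<sigma> P \<and> (\<forall>c\<in>set cs. level c \<le> Suc n) \<and> signed b (Atom P (map Cst cs)) \<in> w"
  by (simp_all add: canonical_struct_def)

lemma canonical_model_simps [simp]:
  "pos (canonical_model \<sigma>) (encode_world v) = canonical_struct \<sigma> True v"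
  "neg (canonical_model \<sigma>) (encode_world v) = canonical_struct \<sigma> False v"
  "encode_world (n, w) \<in> worlds (canonical_model \<sigma>) \<longleftrightarrow> saturated n w"
  by (auto simp: canonical_model_def inv_f_f[OF inj_encode_world]
      inj_image_mem_iff[OF inj_encode_world])

lemma struct_of_canonical_model [simp]:
  "struct_of (canonical_model \<sigma>) b (encode_world v) = canonical_struct \<sigma> b v"
  by (cases b) simp_all

lemma acc_canonical_model:
  assumes "saturated n w"
  shows "(\<forall>v. (encode_world (n, w), v) \<in> acc (canonical_model \<sigma>) \<longrightarrow> P v) \<longleftrightarrow>
      (\<forall>u. accessible n w u \<longrightarrow> P (encode_world (Suc n, u)))"
    and "(\<exists>v. (encode_world (n, w), v) \<in> acc (canonical_model \<sigma>) \<and> P v) \<longleftrightarrow>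
      (\<exists>u. accessible n w u \<and> P (encode_world (Suc n, u)))"
  using assms by (auto simp: canonical_model_def dest!: injD[OF inj_encode_world])

lemma is_struct_canonical_struct: "is_struct \<sigma> (canonical_struct \<sigma> b (n, w))"
proof -
  have "level (Par 0) \<le> Suc n" by simp
  then have "carr (canonical_struct \<sigma> b (n, w)) \<noteq> {}" by (auto simp del: level_simps)
  then show ?thesis by (auto simp: is_struct_def)
qed

lemma is_model_canonical_model:
  fixes \<sigma> :: "('p, 'c) signature"
  assumes "saturated n (w :: ('p, 'c) henkin_fm set)"
  shows "is_model \<sigma> (canonical_model \<sigma>)"
  unfolding is_model_def
proof (intro conjI)
  show "worlds (canonical_model \<sigma>) \<noteq> {}" using assms canonical_model_simps(3)[of n w \<sigma>] by blast
  show "acc (canonical_model \<sigma>) \<subseteq> worlds (canonical_model \<sigma>) \<times> worlds (canonical_model \<sigma>)"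
    by (auto simp: canonical_model_def accessible_def)
  have "\<exists>n w. v = encode_world (n, w)" if "v \<in> worlds (canonical_model \<sigma>)" for v
    using that by (auto simp: canonical_model_def)
  then show "\<forall>v\<in>worlds (canonical_model \<sigma>).
      is_struct \<sigma> (pos (canonical_model \<sigma>) v) \<and> is_struct \<sigma> (neg (canonical_model \<sigma>) v) \<and>
      carr (pos (canonical_model \<sigma>) v) = carr (neg (canonical_model \<sigma>) v) \<and>
      (\<forall>c\<in>csts \<sigma>. cint (pos (canonical_model \<sigma>) v) c = cint (neg (canonical_model \<sigma>) v) c)"
    by (force simp: is_struct_canonical_struct)
  have "\<exists>n w u. v = encode_world (n, w) \<and> v' = encode_world (Suc n, u)"
    if "(v, v') \<in> acc (canonical_model \<sigma>)" for v v'
    using that by (auto simp: canonical_model_def)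
  then show "\<forall>(v, v')\<in>acc (canonical_model \<sigma>).
      carr (pos (canonical_model \<sigma>) v) \<subseteq> carr (pos (canonical_model \<sigma>) v') \<and>
      (\<forall>c\<in>csts \<sigma>. cint (pos (canonical_model \<sigma>) v) c = cint (pos (canonical_model \<sigma>) v') c)"
    by force
qed

definition inst :: "(nat \<Rightarrow> ('p, 'c) fm) \<Rightarrow> ('p, 'c) fm \<Rightarrow> ('p, 'c) henkin_fm" where
  "inst k F = subst (\<lambda>x. Cst (k x)) (map_fm id Old F)"

lemma inst_simps [simp]:
  "inst k Bot = Bot"
  "inst k (Imp F G) = Imp (inst k F) (inst k G)"
  "inst k (And F G) = And (inst k F) (inst k G)"
  "inst k (Or F G) = Or (inst k F) (inst k G)"
  "inst k (SNeg F) = SNeg (inst k F)"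
  "inst k (Box F) = Box (inst k F)"
  "inst k (Dia F) = Dia (inst k F)"
  by (simp_all add: inst_def)

lemma bounded_sentence_inst:
  assumes "\<And>x. level (k x) \<le> n"
  shows "bounded_sentence n (inst k F)"
proof -
  have "set2_fm (inst k F) \<subseteq> range Old \<union> range k"
    using set2_fm_subst[of "\<lambda>x. Cst (k x)" "map_fm id Old F"] by (auto simp: inst_def fm.set_map)
  moreover have "fv (inst k F) = {}"
    using fv_subst[of "\<lambda>x. Cst (k x)" "map_fm id Old F"] by (simp add: inst_def)
  ultimately show ?thesis using assms by (fastforce simp: bounded_sentence_def)
qed

lemma inst_quantifier:
  obtains G where "inst k (Forall x F) = Forall x G" and "inst k (Exists x F) = Exists x G"
    and "fv G \<subseteq> {x}" and "\<And>c. subst1 x (Cst c) G = inst (k(x := c)) F"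
proof
  let ?G = "subst ((\<lambda>x. Cst (k x))(x := Var x)) (map_fm id Old F)"
  show "inst k (Forall x F) = Forall x ?G" and "inst k (Exists x F) = Exists x ?G"
    by (simp_all add: inst_def)
  show "fv ?G \<subseteq> {x}"
    using fv_subst[of "(\<lambda>x. Cst (k x))(x := Var x)" "map_fm id Old F"] by (fastforce split: if_splits)
  have "(\<lambda>y. Cst (k y))(x := Cst c) = (\<lambda>y. Cst ((k(x := c)) y))" for c by auto
  then show "subst1 x (Cst c) ?G = inst (k(x := c)) F" for c
    unfolding inst_def by (subst subst1_subst_closed) (simp_all only: fv_tm.simps)
qed

lemma satisfies_canonical_Atom:
  assumes "wf_fm \<sigma> (Atom P ts)" and "\<And>x. level (k x) \<le> Suc n"
  shows "satisfies (canonical_model \<sigma>) b (encode_world (n, w)) k (Atom P ts) \<longleftrightarrow>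
    signed b (inst k (Atom P ts)) \<in> w"
proof -
  define v where "v = case_tm k Old"
  have "inst k (Atom P ts) = Atom P (map Cst (map v ts))"
    by (auto simp: inst_def v_def split: tm.split)
  moreover have "map (val (canonical_struct \<sigma> b (n, w)) k) ts = map v ts"
    by (auto simp: v_def split: tm.split)
  moreover have "map v ts \<in> pint (canonical_struct \<sigma> b (n, w)) P \<longleftrightarrow>
      signed b (Atom P (map Cst (map v ts))) \<in> w"
    using assms by (auto simp: v_def split: tm.split)
  ultimately show ?thesis by (simp only: satisfies.simps struct_of_canonical_model)
qed

lemma truth_lemma:
  assumes "saturated n w" and "wf_fm \<sigma> F" and "\<And>x. level (k x) \<le> Suc n"
  shows "satisfies (canonical_model \<sigma>) b (encode_world (n, w)) k F \<longleftrightarrow> signed b (inst k F) \<in> w"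
  using assms
proof (induction F arbitrary: n w k b rule: fm_induct)
  case (Atom P ts)
  show ?case using satisfies_canonical_Atom Atom.prems(2,3) .
next
  case (Binary C F G)
  note mcs = saturated_maximal_consistent[OF Binary.prems(1)]
  from Binary.IH[of n w k True] Binary.IH[of n w k False] Binary.hyps Binary.prems show ?case
    by (auto simp: mcs_signed[OF mcs])
next
  case (Modal M F)
  note mcs = saturated_maximal_consistent[OF Modal.prems(1)]
  have bounded: "bounded_sentence (Suc n) (inst k F)"
    using Modal.prems(3) by (rule bounded_sentence_inst)
  have "satisfies (canonical_model \<sigma>) b (encode_world (Suc n, u)) k F \<longleftrightarrow> signed b (inst k F) \<in> u"
    if "accessible n w u" for u b
    using that Modal.hyps Modal.prems(2) le_SucI[OF Modal.prems(3)]
    by (intro Modal.IH) (auto simp: accessible_def)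
  from this[of _ True] this[of _ False] show ?case
    using Modal.hyps saturated_signed_modal[OF mcs bounded]
    by (auto simp: acc_canonical_model[OF Modal.prems(1)] cong: conj_cong)
next
  case (Quantifier Q x F)
  obtain G where inst: "inst k (Forall x F) = Forall x G" "inst k (Exists x F) = Exists x G"
    and G: "fv G \<subseteq> {x}" and subst1: "\<And>c. subst1 x (Cst c) G = inst (k(x := c)) F"
    by (rule inst_quantifier[of k x F]) (rule that)
  have "satisfies (canonical_model \<sigma>) b (encode_world (n, w)) (k(x := c)) F \<longleftrightarrow>
      signed b (subst1 x (Cst c) G) \<in> w" if "level c \<le> Suc n" for c b
    unfolding subst1 using that Quantifier.hyps Quantifier.prems by (intro Quantifier.IH) auto
  from this[of _ True] this[of _ False] show ?case
    using Quantifier.hyps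
    by (auto simp: inst saturated_signed_quantifier[OF Quantifier.prems(1) G] simp del: fun_upd_apply)
qed (simp_all add: saturated_maximal_consistent mcs_signed)

section \<open>Completeness\<close>

lemma derivable_if_derivable_inst_Par:
  fixes T :: "('p, 'c) fm set"
  assumes "T \<subseteq> Form \<sigma>" and "F \<in> Form \<sigma>" and "inst Par ` T \<turnstile> inst Par F"
  shows "T \<turnstile> F"
proof -
  obtain Gs where Gs: "set Gs \<subseteq> inst Par ` T" "provable UNIV (foldr Imp Gs (inst Par F))"
    using assms(3) unfolding derivable_iff_provable by blast
  then have "Gs \<in> lists (inst Par ` T)" by auto
  then obtain Fs where Fs: "set Fs \<subseteq> T" "Gs = map (inst Par) Fs" unfolding lists_image by auto
  let ?G = "foldr Imp Fs F"
  have "foldr Imp Gs (inst Par F) = subst (\<lambda>x. Cst (Par x)) (map_fm id Old ?G)"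
    by (simp add: Fs(2) inst_def[abs_def] foldr_Imp_simps comp_def)
  then have "provable UNIV (subst (\<lambda>x. Cst (Par x)) (map_fm id Old ?G :: ('p, 'c) henkin_fm))"
    using Gs(2) by simp
  then have "provable UNIV (map_fm id Old ?G :: ('p, 'c) henkin_fm)"
    by (rule provable_if_provable_subst_Cst) (auto simp: inj_Par Par_neq_Old fm.set_map)
  moreover have "?G \<in> Form \<sigma>" using Fs(1) assms(1,2) by (auto simp: Form_def foldr_Imp_simps)
  ultimately have "?G \<in> QBK \<sigma>" by (rule QBK_if_provable_map_fm[OF _ inj_Old])
  then have "provable UNIV ?G" using provable_mono QBK_iff_provable by blast
  then show ?thesis using Fs(1) derivable_iff_provable by blast
qed

lemma consequences_foldr_Imp:
  "foldr Imp Fs G \<in> consequences \<sigma> \<Gamma> \<Longrightarrow> set Fs \<subseteq> \<Gamma> \<Longrightarrow> G \<in> consequences \<sigma> \<Gamma>"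
proof (induction Fs)
  case (Cons F Fs)
  then show ?case using consequences.MP[of F \<sigma> \<Gamma> "foldr Imp Fs G"] by (simp add: consequences.base)
qed simp

lemma consequences_if_derivable:
  assumes "\<Gamma> \<turnstile> F" and "\<Gamma> \<subseteq> Form \<sigma>" and "F \<in> Form \<sigma>"
  shows "F \<in> consequences \<sigma> \<Gamma>"
proof -
  obtain Fs where Fs: "set Fs \<subseteq> \<Gamma>" "provable UNIV (foldr Imp Fs F)"
    using assms(1) derivable_iff_provable by blast
  moreover have "foldr Imp Fs F \<in> Form \<sigma>"
    using Fs(1) assms(2,3) by (auto simp: Form_def foldr_Imp_simps)
  ultimately have "foldr Imp Fs F \<in> QBK \<sigma>"
    by (intro QBK_if_provable_map_fm[of id]) (simp_all add: fm.map_id)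
  then show ?thesis using consequences_foldr_Imp[OF consequences.base Fs(1)] by blast
qed

lemma wf_disjunction: "wf_fm \<sigma> (disjunction Fs) \<longleftrightarrow> (\<forall>F\<in>set Fs. wf_fm \<sigma> F)"
  by (induction Fs rule: disjunction.induct) auto

lemma derives_if_inconsistent:
  assumes "\<Gamma> \<subseteq> Form \<sigma>" and "\<Delta> \<subseteq> Form \<sigma>" and "\<Gamma> \<union> Neg ` \<Delta> \<turnstile> Bot"
  shows "derives \<sigma> \<Gamma> \<Delta>"
proof -
  obtain U where U: "U \<subseteq> \<Delta>" "finite U" "\<Gamma> \<union> Neg ` U \<turnstile> Bot"
    using derivable_Un_imageE[OF assms(3)] .
  obtain Fs where Fs: "set Fs = U" using finite_list[OF U(2)] by blast
  have "\<Gamma> \<turnstile> disjunction Fs" using U(3) Fs by (simp add: derivable_disjunction_if_inconsistent)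
  moreover have "disjunction Fs \<in> Form \<sigma>"
    using U(1) Fs assms(2) by (auto simp: Form_def wf_disjunction)
  ultimately have "disjunction Fs \<in> consequences \<sigma> \<Gamma>"
    using assms(1) by (intro consequences_if_derivable)
  then show ?thesis using U(1) Fs by (auto simp: derives_def Disj_def)
qed

lemma verifies_canonical_model_iff:
  assumes w: "saturated n w" and k: "\<And>x. level (k x) \<le> Suc n" and F: "F \<in> Form \<sigma>"
  shows "verifies (canonical_model \<sigma>) (encode_world (n, w)) (subst (\<lambda>x. Cst (Inr (k x))) (lift F)) \<longleftrightarrow>
    inst k F \<in> w"
proof -
  have "range (\<lambda>x. Cst (Inr (k x))) \<subseteq> Cst ` (csts \<sigma> <+> {c. level c \<le> Suc n})" using k by auto
  then show ?thesis
    using verifies_subst_lift[OF is_model_canonical_model[OF w] _ _ F]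
      truth_lemma[OF w _ k, of \<sigma> F True] w F
    by (simp add: env_of_def Form_def)
qed

theorem completeness:
  fixes \<sigma> :: "('p, 'c) signature"
  assumes \<Gamma>: "\<Gamma> \<subseteq> Sent \<sigma>" and \<Delta>: "\<Delta> \<subseteq> Form \<sigma>"
    and "entails TYPE(('p, 'c) fm) TYPE(('p, 'c) fm set) \<sigma> \<Gamma> \<Delta>"
  shows "derives \<sigma> \<Gamma> \<Delta>"
proof (rule ccontr)
  let ?T = "inst Par ` (\<Gamma> \<union> Neg ` \<Delta>) :: ('p, 'c) henkin_fm set"
  let ?M = "canonical_model \<sigma>" and ?s = "\<lambda>x. Cst (Inr (Par x)) :: ('c + ('p, 'c) fm) tm"
  assume "\<not> derives \<sigma> \<Gamma> \<Delta>"
  moreover have forms: "\<Gamma> \<subseteq> Form \<sigma>" "\<Gamma> \<union> Neg ` \<Delta> \<subseteq> Form \<sigma>" using \<Gamma> \<Delta> by (auto simp: Sent_def Form_def)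
  ultimately have "consistent (\<Gamma> \<union> Neg ` \<Delta>)" using derives_if_inconsistent \<Delta> by blast
  then have "consistent ?T"
    using derivable_if_derivable_inst_Par[OF forms(2), of Bot] by (auto simp: Form_def)
  moreover have "bounded_sentence 0 G" if "G \<in> ?T" for G
    using that by (auto intro!: bounded_sentence_inst simp del: inst_simps)
  ultimately obtain w where w: "?T \<subseteq> w" "saturated 0 w" by (rule saturated_extension)
  let ?v = "encode_world (0, w)"
  have verifies: "verifies ?M ?v (subst ?s (lift F)) \<longleftrightarrow> inst Par F \<in> w" if "F \<in> Form \<sigma>" for F
    using that by (intro verifies_canonical_model_iff w) simp_all
  have "verifies ?M ?v (lift F)" if "F \<in> \<Gamma>" for F
  proof -
    have "F \<in> Sent \<sigma>" "F \<in> Form \<sigma>" "inst Par F \<in> w" using that \<Gamma> forms(1) w(1) by auto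
    then show ?thesis using verifies[of F] by (simp add: subst_lift_sentence)
  qed
  moreover have "is_subst \<sigma> (carr (pos ?M ?v)) ?s \<and> ground ?s"
    unfolding ground_subst_iff by auto
  ultimately obtain G where G: "G \<in> \<Delta>" "verifies ?M ?v (subst ?s (lift G))"
    using assms(3) is_model_canonical_model[OF w(2)] w(2) unfolding entails_def
    by (metis canonical_model_simps(3))
  then have "inst Par G \<in> w" using verifies \<Delta> by blast
  moreover have "inst Par (Neg G) \<in> w" using w(1) G(1) by blast
  ultimately show False
    using saturated_maximal_consistent[OF w(2)] by (simp add: mcs_Imp mcs_Bot)
qed

theorem theorem15:
  fixes \<sigma> :: "('p, 'c) signature"
    and \<Gamma> \<Delta> :: "('p, 'c) fm set"
  assumes "\<Gamma> \<subseteq> Sent \<sigma>" and "\<Delta> \<subseteq> Form \<sigma>"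
  shows "(derives \<sigma> \<Gamma> \<Delta> \<longleftrightarrow> entails TYPE(('p, 'c) fm) TYPE(('p, 'c) fm set) \<sigma> \<Gamma> \<Delta>) \<and>
         (derives \<sigma> \<Gamma> \<Delta> \<longrightarrow> entails TYPE('a) TYPE('w) \<sigma> \<Gamma> \<Delta>)"
  using soundness[OF assms, where 'a = "('p, 'c) fm" and 'w = "('p, 'c) fm set"]
    soundness[OF assms, where 'a = 'a and 'w = 'w] completeness[OF assms]
  by blast

end
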